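(* The sets $\mathit{TpcN}\setminus\mathit{Normal}$ and $\mathit{Normal}\setminus\mathit{TpcN}$ are nonempty. Moreover, each of them is $D_2(\Pi^0_3)$-complete: it belongs to $D_2(\Pi^0_3)$ and is $D_2(\Pi^0_3)$-hard, i.e. it is not the complement of a set in $D_2(\Pi^0_3)$.
   Context: A number $y\in[0,1]$ is identified with its binary expansion $x\in\{0,1\}^{\mathbb N}$, where $y=\sum_n x_n2^{-n}$. For $n\ge1$, $L_n(x)$ is the length of the longest run of consecutive ones among $x_1,\dots,x_n$. A number is typical if $\lim_{n\to\infty} L_n(x)/\log_2 n=1$, and $\mathit{TpcN}$ is the set of typical numbers in $[0,1]$. A number is normal (in base 2) if for every $m\ge1$ and every finite block $\omega\in\{0,1\}^m$, the number $N(x,\omega,n)$ of occurrences of $\omega$ among the first $n$ digits satisfies $\lim_{n\to\infty} N(x,\omega,n)/n=2^{-m}$. $\mathit{Normal}$ is the set of normal numbers in $[0,1]$. Numbers with two binary expansions are neither typical nor normal. $\Pi^0_3$ denotes the third multiplicative level of the Borel hierarchy. $D_2(\Pi^0_3)$ denotes the class of sets of the form $A\setminus B$ with $A,B\in\Pi^0_3$. *)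

theory Defs
  imports "HOL-Analysis.Analysis"
begin

text \<open>Digit sequences are indexed from 0, so the digit \<open>x\<^sub>n\<^sub>+\<^sub>1\<close> of the usual
  numbering is \<open>x n\<close>, with weight \<open>1 / 2 ^ Suc n\<close>.\<close>

definition binary_expansion :: "(nat \<Rightarrow> bool) \<Rightarrow> real \<Rightarrow> bool" where
  "binary_expansion x y \<longleftrightarrow> (\<lambda>n. of_bool (x n) / 2 ^ Suc n) sums y"

definition longest_run :: "(nat \<Rightarrow> bool) \<Rightarrow> nat \<Rightarrow> nat" where
  "longest_run x n = Max {l. \<exists>k. k + l \<le> n \<and> (\<forall>i\<in>{k..<k + l}. x i)}"

text \<open>Occurrences may overlap and lie entirely within the first \<open>n\<close> digits.\<close>

definition occurrences :: "(nat \<Rightarrow> bool) \<Rightarrow> bool list \<Rightarrow> nat \<Rightarrow> nat" where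
  "occurrences x w n = card {i. i + length w \<le> n \<and> (\<forall>j<length w. x (i + j) = w ! j)}"

definition typical_seq :: "(nat \<Rightarrow> bool) \<Rightarrow> bool" where
  "typical_seq x \<longleftrightarrow> (\<lambda>n. real (longest_run x n) / log 2 (real n)) \<longlonglongrightarrow> 1"

definition normal_seq :: "(nat \<Rightarrow> bool) \<Rightarrow> bool" where
  "normal_seq x \<longleftrightarrow>
    (\<forall>m\<ge>1. \<forall>w. length w = m \<longrightarrow> (\<lambda>n. real (occurrences x w n) / real n) \<longlonglongrightarrow> 1 / 2 ^ m)"

text \<open>Requiring the binary expansion to be unique excludes the numbers with two expansions.\<close>

definition TpcN :: "real set" where
  "TpcN = {y \<in> {0..1}. (\<exists>!x. binary_expansion x y) \<and>
                       (\<exists>x. binary_expansion x y \<and> typical_seq x)}"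

definition Normal :: "real set" where
  "Normal = {y \<in> {0..1}. (\<exists>!x. binary_expansion x y) \<and>
                         (\<exists>x. binary_expansion x y \<and> normal_seq x)}"

text \<open>The multiplicative levels of the Borel hierarchy are: closed sets, countable intersections
  of open sets, countable intersections of \<open>F\<^sub>\<sigma>\<close> sets (the third), and so on. The form of the
  definition follows the one of \<^const>\<open>gdelta_in\<close>; \<open>relative_to\<close> only takes care
  of the empty intersection.\<close>

definition pi03_in :: "'a topology \<Rightarrow> 'a set \<Rightarrow> bool" where
  "pi03_in X = (countable intersection_of fsigma_in X) relative_to topspace X"

definition D2 :: "('a set \<Rightarrow> bool) \<Rightarrow> 'a set \<Rightarrow> bool" where
  "D2 \<Gamma> S \<longleftrightarrow> (\<exists>A B. \<Gamma> A \<and> \<Gamma> B \<and> S = A - B)"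

definition D2_pi03_hard :: "'a topology \<Rightarrow> 'a set \<Rightarrow> bool" where
  "D2_pi03_hard X S \<longleftrightarrow> \<not> (\<exists>C. D2 (pi03_in X) C \<and> S = topspace X - C)"

definition D2_pi03_complete :: "'a topology \<Rightarrow> 'a set \<Rightarrow> bool" where
  "D2_pi03_complete X S \<longleftrightarrow> D2 (pi03_in X) S \<and> D2_pi03_hard X S"

end

theory Submission imports Defs "HOL-Real_Asymp.Real_Asymp" begin

text \<open>Both hardness claims, and both nonemptiness claims, follow from one realization principle: for
  any two \<open>\<Pi>\<^sup>0\<^sub>3\<close> sets \<open>A\<close>, \<open>B\<close> there is a \<open>y\<close> that is typical iff \<open>y \<in> A\<close> and normal
  iff \<open>y \<in> B\<close>. If \<open>TpcN - Normal\<close> were the complement of \<open>A - B\<close>, this \<open>y\<close> would belong to both or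
  to neither of them.

  To find \<open>y\<close>, start from a Champernowne-like sequence that is normal and typical. Stage \<open>s\<close> lists
  all words of length \<open>s\<close>, each followed by two zeros; it begins at \<open>s * 2 ^ s\<close>. Given numbers
  \<open>p s\<close> and \<open>q s\<close>, modify the beginning of the stage: write zeros on a proportion of about
  \<open>1 / (q s + 2)\<close> of it, except for one run of ones of length about \<open>s * (1 + 1 / (p s + 1))\<close>. Then
  the sequence is typical iff \<open>p\<close> tends to infinity, and normal iff \<open>q\<close> does. Membership in a
  \<open>\<Pi>\<^sup>0\<^sub>3\<close> set is equivalent to the divergence of a sequence of guesses, each depending on a finite
  prefix only. As the digits of a stage may depend on all earlier digits, \<open>p\<close> and \<open>q\<close> can be
  taken to be the guesses about the very number under construction.\<close>

subsection \<open>Binary expansions\<close>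

text \<open>Left endpoint of the dyadic cell of length \<open>1 / 2 ^ n\<close> formed by the values
  of all sequences that share the first \<open>n\<close> digits of \<open>x\<close>.\<close>

definition prefix_value :: "(nat \<Rightarrow> bool) \<Rightarrow> nat \<Rightarrow> real" where
  "prefix_value x n = (\<Sum>i<n. of_bool (x i) / 2 ^ Suc i)"

lemma prefix_value_Suc [simp]:
  "prefix_value x (Suc n) = prefix_value x n + of_bool (x n) / 2 ^ Suc n"
  by (simp add: prefix_value_def)

lemma prefix_value_cong: "(\<And>i. i < n \<Longrightarrow> x i = x' i) \<Longrightarrow> prefix_value x n = prefix_value x' n"
  by (simp add: prefix_value_def)

lemma prefix_value_rat: "prefix_value x n \<in> \<rat>"
  by (induction n) (auto simp: prefix_value_def of_bool_def)

lemma incseq_prefix_value: "incseq (prefix_value x)"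
  by (rule incseq_SucI) simp

lemma decseq_prefix_value: "decseq (\<lambda>n. prefix_value x n + 1 / 2 ^ n)"
  by (rule decseq_SucI) (simp add: of_bool_def field_simps)

lemma binary_expansion_iff_tendsto: "binary_expansion x y \<longleftrightarrow> prefix_value x \<longlonglongrightarrow> y"
  unfolding binary_expansion_def sums_def prefix_value_def ..

lemma tendsto_prefix_value_upper:
  "prefix_value x \<longlonglongrightarrow> y \<Longrightarrow> (\<lambda>n. prefix_value x n + 1 / 2 ^ n) \<longlonglongrightarrow> y"
  using tendsto_add[OF _ LIMSEQ_divide_realpow_zero[of 2 1], of "prefix_value x" y] by simp

lemma binary_expansion_ge: "binary_expansion x y \<Longrightarrow> prefix_value x n \<le> y"
  using incseq_le[OF incseq_prefix_value] by (simp add: binary_expansion_iff_tendsto)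

lemma binary_expansion_le: "binary_expansion x y \<Longrightarrow> y \<le> prefix_value x n + 1 / 2 ^ n"
  using decseq_ge[OF decseq_prefix_value tendsto_prefix_value_upper, of x y n]
  by (simp add: binary_expansion_iff_tendsto)

text \<open>A one at or after position \<open>n\<close> moves the value off the left endpoint of its
  cell, just as a zero moves it off the right endpoint in \<open>binary_expansion_less\<close>. This
  strictness later excludes a second expansion.\<close>

lemma binary_expansion_gt:
  assumes "binary_expansion x y" "i \<ge> n" "x i" shows "prefix_value x n < y"
proof -
  have "prefix_value x n \<le> prefix_value x i"
    using incseq_prefix_value assms(2) by (rule incseqD)
  also have "\<dots> < prefix_value x (Suc i)" using assms(3) by simp
  finally show ?thesis using binary_expansion_ge[OF assms(1), of "Suc i"] by simp
qed

lemma binary_expansion_less: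
  assumes "binary_expansion x y" "i \<ge> n" "\<not> x i" shows "y < prefix_value x n + 1 / 2 ^ n"
proof -
  have "prefix_value x (Suc i) + 1 / 2 ^ Suc i < prefix_value x i + 1 / 2 ^ i"
    using assms(3) by (simp add: divide_simps)
  also have "\<dots> \<le> prefix_value x n + 1 / 2 ^ n"
    using decseq_prefix_value assms(2) by (rule decseqD)
  finally show ?thesis using binary_expansion_le[OF assms(1), of "Suc i"] by simp
qed

definition bin_val :: "(nat \<Rightarrow> bool) \<Rightarrow> real" where
  "bin_val x = (\<Sum>n. of_bool (x n) / 2 ^ Suc n)"

lemma binary_expansion_bin_val: "binary_expansion x (bin_val x)"
proof -
  have "summable (\<lambda>n. (1/2::real) ^ Suc n)"
    using sums_summable[OF power_half_series] by (simp add: power_divide)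
  then have "summable (\<lambda>n. of_bool (x n) / 2 ^ Suc n :: real)"
    by (rule summable_comparison_test'[where N = 0]) (simp add: of_bool_def power_divide)
  then show ?thesis
    unfolding binary_expansion_def bin_val_def by (rule summable_sums)
qed

lemma binary_expansion_bounds: "binary_expansion x y \<Longrightarrow> y \<in> {0..1}"
  using binary_expansion_ge[of x y 0] binary_expansion_le[of x y 0] by (simp add: prefix_value_def)

text \<open>At the first difference one sequence enters the right half of the common cell and the
  other the left half. The closed halves meet only in the midpoint, which is therefore the common
  value.\<close>

lemma binary_expansion_first_difference:
  assumes x: "binary_expansion x y" and x': "binary_expansion x' y" and ne: "x \<noteq> x'"
  obtains n where "y = prefix_value x n" "y = prefix_value x' n + 1 / 2 ^ n"
  | n where "y = prefix_value x' n" "y = prefix_value x n + 1 / 2 ^ n"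
proof -
  define n where "n = (LEAST n. x n \<noteq> x' n)"
  have n: "x n \<noteq> x' n"
    unfolding n_def using ne by (intro LeastI_ex[of "\<lambda>n. x n \<noteq> x' n"]) (simp add: fun_eq_iff)
  have eq: "x i = x' i" if "i < n" for i
    using that not_less_Least[of i "\<lambda>n. x n \<noteq> x' n"] unfolding n_def by blast
  have pre: "prefix_value x n = prefix_value x' n"
    using eq by (rule prefix_value_cong)
  note b = binary_expansion_ge[OF x, of "Suc n"] binary_expansion_le[OF x, of "Suc n"]
    binary_expansion_ge[OF x', of "Suc n"] binary_expansion_le[OF x', of "Suc n"]
  show thesis
  proof (cases "x n")
    case True
    with n have "\<not> x' n" by simp
    with True pre b show thesis by (intro that(1)[of "Suc n"]) auto
  next
    case False
    with n have "x' n" by simp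
    with False pre b show thesis by (intro that(2)[of "Suc n"]) auto
  qed
qed

lemma unique_binary_expansion_irrational:
  assumes "binary_expansion x y" "binary_expansion x' y" "y \<notin> \<rat>" shows "x = x'"
  using binary_expansion_first_difference[OF assms(1,2)] assms(3) prefix_value_rat by metis

lemma unique_binary_expansion_not_eventually_const:
  assumes x: "binary_expansion x y" and x': "binary_expansion x' y"
    and inf1: "\<And>n. \<exists>i\<ge>n. x i" and inf0: "\<And>n. \<exists>i\<ge>n. \<not> x i"
  shows "x' = x"
proof (rule ccontr)
  assume "x' \<noteq> x"
  then have "x \<noteq> x'" by simp
  then show False
  proof (rule binary_expansion_first_difference[OF x x'])
    fix n assume "y = prefix_value x n"
    then show False using inf1[of n] binary_expansion_gt[OF x, of n] by (metis less_irrefl)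
  next
    fix n assume "y = prefix_value x n + 1 / 2 ^ n"
    then show False using inf0[of n] binary_expansion_less[OF x, of n] by (metis less_irrefl)
  qed
qed

lemma binary_expansion_exists:
  assumes "y \<in> {0..1}" obtains x where "binary_expansion x y"
proof (cases "y = 1")
  case True
  have "(\<lambda>n. 1 / 2 ^ Suc n) sums (1::real)" using power_half_series by (simp add: power_divide)
  then show thesis using that[of "\<lambda>_. True"] True by (simp add: binary_expansion_def)
next
  case False
  \<comment> \<open>\<open>f n\<close> is the integer written by the first \<open>n\<close> digits,
    so every new digit is a parity. The case \<open>y = 1\<close> is treated apart because
    \<open>f 0 = 0\<close> is needed here.\<close>
  define f where "f n = \<lfloor>2 ^ n * y\<rfloor>" for n
  define x where "x n = odd (f (Suc n))" for n
  have half: "f (Suc n) div 2 = f n" for n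
    using floor_divide_real_eq_div[of 2 "2 ^ Suc n * y"] by (simp add: f_def)
  have step: "f (Suc n) = 2 * f n + of_bool (x n)" for n
    using half[of n] div_mult_mod_eq[of "f (Suc n)" 2]
    by (cases "x n") (auto simp: x_def even_iff_mod_2_eq_zero odd_iff_mod_2_eq_one)
  have "prefix_value x n = f n / 2 ^ n" for n
  proof (induction n)
    case 0
    have "f 0 = 0" using assms False by (simp add: f_def floor_eq_iff)
    then show ?case by (simp add: prefix_value_def)
  next
    case (Suc n)
    then show ?case by (simp add: step add_divide_distrib)
  qed
  moreover have "(\<lambda>n. f n / 2 ^ n) \<longlonglongrightarrow> y"
  proof (rule tendsto_sandwich)
    have "y - 1 / 2 ^ n \<le> f n / 2 ^ n" for n
    proof -
      have "2 ^ n * y - 1 \<le> f n" unfolding f_def by linarith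
      then have "(2 ^ n * y - 1) / 2 ^ n \<le> f n / 2 ^ n" by (simp add: divide_right_mono)
      then show ?thesis by (simp add: diff_divide_distrib)
    qed
    then show "\<forall>\<^sub>F n in sequentially. y - 1 / 2 ^ n \<le> f n / 2 ^ n" by simp
    show "\<forall>\<^sub>F n in sequentially. f n / 2 ^ n \<le> y"
      by (rule always_eventually) (auto simp: f_def field_simps)
    show "(\<lambda>n. y - 1 / 2 ^ n) \<longlonglongrightarrow> y"
      using tendsto_diff[OF tendsto_const LIMSEQ_divide_realpow_zero[of 2 1], of y] by simp
  qed simp
  ultimately show thesis
    using that[of x] unfolding binary_expansion_iff_tendsto by presburger
qed

text \<open>Rescaling the cell to the unit interval and expanding the rescaled point supplies the
  missing digits. The right endpoint is included; its tail consists of ones.\<close>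

lemma binary_expansion_extend_prefix:
  assumes "prefix_value x n \<le> y" "y \<le> prefix_value x n + 1 / 2 ^ n"
  obtains x' where "binary_expansion x' y" "\<And>i. i < n \<Longrightarrow> x' i = x i"
proof -
  define z where "z = (y - prefix_value x n) * 2 ^ n"
  have "z \<in> {0..1}" using assms by (simp add: z_def field_simps)
  then obtain u where u: "binary_expansion u z" by (rule binary_expansion_exists)
  define x' where "x' i = (if i < n then x i else u (i - n))" for i
  have "(\<lambda>i. of_bool (u i) / 2 ^ Suc i / 2 ^ n) sums (z / 2 ^ n)"
    using u unfolding binary_expansion_def by (rule sums_divide)
  then have "(\<lambda>i. of_bool (x' (i + n)) / 2 ^ Suc (i + n)) sums (y - prefix_value x n)"
    by (simp add: x'_def z_def power_add mult.assoc)
  moreover have "prefix_value x n = (\<Sum>i<n. of_bool (x' i) / 2 ^ Suc i)"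
    by (simp add: x'_def prefix_value_def)
  ultimately have "binary_expansion x' y"
    unfolding binary_expansion_def
    using sums_iff_shift'[of "\<lambda>i. of_bool (x' i) / 2 ^ Suc i" n y] by simp
  then show thesis by (rule that) (simp add: x'_def)
qed

subsection \<open>The upper bound\<close>

text \<open>Dependence without anticipation. It bounds the complexity of limit conditions and later
  lets a sequence be built from guesses about itself.\<close>

definition determined_by_prefix :: "((nat \<Rightarrow> bool) \<Rightarrow> nat \<Rightarrow> 'b) \<Rightarrow> bool" where
  "determined_by_prefix R \<longleftrightarrow> (\<forall>x x' n. (\<forall>i<n. x i = x' i) \<longrightarrow> R x n = R x' n)"

lemma determined_by_prefixD:
  "determined_by_prefix R \<Longrightarrow> (\<And>i. i < n \<Longrightarrow> x i = x' i) \<Longrightarrow> R x n = R x' n"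
  unfolding determined_by_prefix_def by blast

section \<open>Countable intersections and limit conditions in the class
  \<open>pi03_in\<close>\<close>

definition unique_expansion :: "real set" where
  "unique_expansion = {y \<in> {0..1}. \<exists>!x. binary_expansion x y}"

lemma pi03_inI:
  assumes "countable K" "\<And>k. k \<in> K \<Longrightarrow> fsigma_in X (S k)" "A = topspace X \<inter> (\<Inter>k\<in>K. S k)"
  shows "pi03_in X A"
  unfolding pi03_in_def relative_to_def intersection_of_def
  using assms by (intro exI[of _ "\<Inter>k\<in>K. S k"]) (auto intro!: exI[of _ "S ` K"])

lemma pi03_inE:
  assumes "pi03_in X A"
  obtains S :: "nat \<Rightarrow> 'a set" where "\<And>k. fsigma_in X (S k)" "A = topspace X \<inter> (\<Inter>k. S k)"
proof -
  obtain \<G> where \<G>: "countable \<G>" "\<And>G. G \<in> \<G> \<Longrightarrow> fsigma_in X G" "A = topspace X \<inter> \<Inter>\<G>"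
    using assms unfolding pi03_in_def relative_to_def intersection_of_def by auto
  \<comment> \<open>Adding the whole space makes the family nonempty, hence enumerable by
    \<open>from_nat_into\<close>, and leaves the intersection within the space unchanged.\<close>
  define \<H> where "\<H> = insert (topspace X) \<G>"
  have "countable \<H>" "\<H> \<noteq> {}" using \<G> by (auto simp: \<H>_def)
  then have r: "range (from_nat_into \<H>) = \<H>" by (metis range_from_nat_into)
  show thesis
  proof (rule that)
    show "fsigma_in X (from_nat_into \<H> k)" for k
      using r \<G>(2) fsigma_in_topspace by (metis \<H>_def insertE rangeI)
    show "A = topspace X \<inter> (\<Inter>k. from_nat_into \<H> k)"
      unfolding r using \<G>(3) by (auto simp: \<H>_def)
  qed
qed

lemma pi03_in_INT:
  assumes "countable K" "\<And>k. k \<in> K \<Longrightarrow> pi03_in X (A k)"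
  shows "pi03_in X (topspace X \<inter> (\<Inter>k\<in>K. A k))"
proof -
  have "\<forall>k\<in>K. \<exists>S. (\<forall>n::nat. fsigma_in X (S n)) \<and> A k = topspace X \<inter> (\<Inter>n. S n)"
    using assms(2) pi03_inE by metis
  then obtain S where S: "\<And>k n. k \<in> K \<Longrightarrow> fsigma_in X (S k n)"
    "\<And>k. k \<in> K \<Longrightarrow> A k = topspace X \<inter> (\<Inter>n::nat. S k n)"
    by metis
  show ?thesis
    by (rule pi03_inI[of "K \<times> UNIV" _ "\<lambda>(k, n). S k n"]) (use assms(1) S in auto)
qed

lemma pi03_in_Int: "pi03_in X A \<Longrightarrow> pi03_in X B \<Longrightarrow> pi03_in X (topspace X \<inter> (A \<inter> B))"
  using pi03_in_INT[of "{False, True}" X "\<lambda>b. if b then A else B"] by (simp add: Int_commute)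

text \<open>Two expansions occur only at rationals, so the exceptional set is countable. Removing
  its points one by one is a countable intersection of relatively open sets, which are
  \<open>fsigma_in\<close> by metrizability.\<close>

lemma pi03_in_unique_expansion: "pi03_in (top_of_set {0..1}) unique_expansion"
proof -
  have "countable ({0..1} - unique_expansion)"
  proof (rule countable_subset)
    show "{0..1} - unique_expansion \<subseteq> \<rat>"
    proof
      fix y :: real assume y: "y \<in> {0..1} - unique_expansion"
      then obtain x where x: "binary_expansion x y" using binary_expansion_exists[of y] by auto
      with y obtain x' where "binary_expansion x' y" "x' \<noteq> x"
        unfolding unique_expansion_def by auto
      with x show "y \<in> \<rat>" using unique_binary_expansion_irrational by metis
    qed
  qed (rule countable_rat)
  moreover have "fsigma_in (top_of_set {0..1}) ({0..1} - {d})" for d :: real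
    by (intro open_imp_fsigma_in) (auto simp: openin_open metrizable_space_subtopology
        metrizable_space_euclidean intro!: exI[of _ "- {d}"])
  ultimately show ?thesis
    by (intro pi03_inI[where S = "\<lambda>d. {0..1} - {d}"]) (auto simp: unique_expansion_def)
qed

text \<open>There are finitely many cells of level \<open>n\<close>, so the closed cells of the good
  prefixes have a closed union. Shared endpoints cause no ambiguity, as the comparison is made only
  on \<open>unique_expansion\<close>.\<close>

lemma expansion_prefix_property_closed:
  assumes "\<And>x x'. (\<And>i. i < n \<Longrightarrow> x i = x' i) \<Longrightarrow> \<phi> x = \<phi> x'"
  obtains F where "closed F"
    "\<And>x y. binary_expansion x y \<Longrightarrow> y \<in> unique_expansion \<Longrightarrow> y \<in> F \<longleftrightarrow> \<phi> x"
proof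
  define F where "F = (\<Union>a\<in>(\<lambda>x. prefix_value x n) ` {x. \<phi> x}. {a..a + 1 / 2 ^ n})"
  have "prefix_value x n \<in> (\<lambda>J. \<Sum>i<n. of_bool (i \<in> J) / 2 ^ Suc i) ` Pow {..<n}" for x
    by (rule image_eqI[of _ _ "{i. i < n \<and> x i}"]) (auto simp: prefix_value_def)
  then have "(\<lambda>x. prefix_value x n) ` {x. \<phi> x} \<subseteq> (\<lambda>J. \<Sum>i<n. of_bool (i \<in> J) / 2 ^ Suc i) ` Pow {..<n}"
    by blast
  then have "finite ((\<lambda>x. prefix_value x n) ` {x. \<phi> x})"
    by (rule finite_subset) simp
  then show "closed F"
    unfolding F_def by (intro closed_UN) auto
  fix x y assume x: "binary_expansion x y" and y: "y \<in> unique_expansion"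
  show "y \<in> F \<longleftrightarrow> \<phi> x"
  proof
    assume "y \<in> F"
    then obtain u where u: "\<phi> u" "prefix_value u n \<le> y" "y \<le> prefix_value u n + 1 / 2 ^ n"
      by (auto simp: F_def)
    then obtain x' where x': "binary_expansion x' y" "\<And>i. i < n \<Longrightarrow> x' i = u i"
      using binary_expansion_extend_prefix by metis
    then have "x' = x" using x y by (auto simp: unique_expansion_def)
    then show "\<phi> x" using assms[of x u] x'(2) u(1) by simp
  next
    assume "\<phi> x"
    then show "y \<in> F"
      unfolding F_def using binary_expansion_ge[OF x, of n] binary_expansion_le[OF x, of n] by auto
  qed
qed

text \<open>Convergence says that for every \<open>k\<close> the error is below
  \<open>1 / (k + 1)\<close> from some \<open>N\<close> on. On \<open>unique_expansion\<close> each
  such error condition, though a strict inequality, is closed because it concerns a prefix; the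
  quantifiers then give a countable intersection of \<open>fsigma_in\<close> sets.\<close>

lemma pi03_in_prefix_limit:
  fixes R :: "(nat \<Rightarrow> bool) \<Rightarrow> nat \<Rightarrow> real"
  assumes R: "determined_by_prefix R"
  shows "pi03_in (top_of_set {0..1})
    {y \<in> unique_expansion. \<exists>x. binary_expansion x y \<and> R x \<longlonglongrightarrow> c}"
proof -
  have "\<exists>F. closed F \<and> (\<forall>x y. binary_expansion x y \<longrightarrow> y \<in> unique_expansion \<longrightarrow>
    (y \<in> F \<longleftrightarrow> dist (R x n) c < inverse (Suc k)))" for n k :: nat
    by (rule expansion_prefix_property_closed[of n "\<lambda>x. dist (R x n) c < inverse (Suc k)"])
      (use determined_by_prefixD[OF R, of n] in metis, blast)
  then obtain F where F: "\<And>n k. closed (F n k)"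
    "\<And>n k x y. binary_expansion x y \<Longrightarrow> y \<in> unique_expansion \<Longrightarrow>
      y \<in> F n k \<longleftrightarrow> dist (R x n) c < inverse (Suc k)"
    by metis
  define S where "S k = (\<Union>N. \<Inter>n\<in>{N..}. {0..1} \<inter> F n k)" for k
  have "fsigma_in (top_of_set {0..1}) (S k)" for k
    unfolding S_def
    by (intro fsigma_in_Union) (auto intro!: closed_imp_fsigma_in closed_INT closed_subset
        closed_Int F closedin_closed_Int)
  then have "pi03_in (top_of_set {0..1}) ({0..1} \<inter> (\<Inter>k. S k))"
    by (intro pi03_inI[of UNIV]) auto
  then have "pi03_in (top_of_set {0..1}) (topspace (top_of_set {0..1}) \<inter>
      (unique_expansion \<inter> ({0..1} \<inter> (\<Inter>k. S k))))"
    by (rule pi03_in_Int[OF pi03_in_unique_expansion])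
  also have "topspace (top_of_set {0..1}) \<inter> (unique_expansion \<inter> ({0..1} \<inter> (\<Inter>k. S k))) =
    {y \<in> unique_expansion. \<exists>x. binary_expansion x y \<and> R x \<longlonglongrightarrow> c}"
  proof -
    have "y \<in> (\<Inter>k. S k) \<longleftrightarrow> (\<exists>x. binary_expansion x y \<and> R x \<longlonglongrightarrow> c)" if y: "y \<in> unique_expansion" for y
    proof -
      obtain x where x: "binary_expansion x y" "\<And>x'. binary_expansion x' y \<Longrightarrow> x' = x"
        using y unfolding unique_expansion_def by blast
      have y01: "y \<in> {0..1}" using y by (simp add: unique_expansion_def)
      have "y \<in> (\<Inter>k. S k) \<longleftrightarrow> (\<forall>k. \<exists>N. \<forall>n\<ge>N. y \<in> F n k)"
      proof -
        have "y \<in> S k \<longleftrightarrow> (\<exists>N. \<forall>n\<ge>N. y \<in> F n k)" for k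
          using y01 by (auto simp: S_def)
        then show ?thesis by simp
      qed
      also have "\<dots> \<longleftrightarrow> (\<forall>k. \<exists>N. \<forall>n\<ge>N. dist (R x n) c < inverse (Suc k))"
        using F(2)[OF x(1) y] by simp
      also have "\<dots> \<longleftrightarrow> R x \<longlonglongrightarrow> c"
        unfolding lim_sequentially
      proof (intro iffI allI impI)
        fix r :: real assume *: "\<forall>k. \<exists>N. \<forall>n\<ge>N. dist (R x n) c < inverse (Suc k)" and "0 < r"
        obtain k :: nat where "inverse (Suc k) < r" using reals_Archimedean[OF \<open>0 < r\<close>] by auto
        with * show "\<exists>N. \<forall>n\<ge>N. dist (R x n) c < r" by (meson order.strict_trans)
      qed simp
      finally show ?thesis using x by blast
    qed
    moreover have "unique_expansion \<subseteq> {0..1}" by (auto simp: unique_expansion_def)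
    ultimately have "unique_expansion \<inter> ({0..1} \<inter> (\<Inter>k. S k)) =
      {y \<in> unique_expansion. \<exists>x. binary_expansion x y \<and> R x \<longlonglongrightarrow> c}" by blast
    with \<open>unique_expansion \<subseteq> {0..1}\<close> show ?thesis by auto
  qed
  finally show ?thesis .
qed

lemma determined_by_prefix_longest_run: "determined_by_prefix longest_run"
  unfolding determined_by_prefix_def longest_run_def
  by (intro allI impI arg_cong[of _ _ Max] Collect_cong ex_cong conj_cong ball_cong) auto

lemma determined_by_prefix_occurrences: "determined_by_prefix (\<lambda>x. occurrences x w)"
  unfolding determined_by_prefix_def occurrences_def
  by (intro allI impI arg_cong[of _ _ card] Collect_cong conj_cong all_cong) auto

lemma pi03_in_TpcN: "pi03_in (top_of_set {0..1}) TpcN"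
proof -
  have "determined_by_prefix (\<lambda>x n. real (longest_run x n) / log 2 (real n))"
    using determined_by_prefix_longest_run unfolding determined_by_prefix_def by metis
  from pi03_in_prefix_limit[OF this, of 1] show ?thesis
    by (simp add: TpcN_def typical_seq_def unique_expansion_def conj_assoc)
qed

lemma pi03_in_Normal: "pi03_in (top_of_set {0..1}) Normal"
proof -
  define S where "S w = {y \<in> unique_expansion. \<exists>x. binary_expansion x y \<and>
    (\<lambda>n. real (occurrences x w n) / real n) \<longlonglongrightarrow> 1 / 2 ^ length w}" for w
  have "determined_by_prefix (\<lambda>x n. real (occurrences x w n) / real n)" for w
    using determined_by_prefix_occurrences[of w] unfolding determined_by_prefix_def by metis
  then have "pi03_in (top_of_set {0..1}) (S w)" for w
    unfolding S_def by (rule pi03_in_prefix_limit)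
  then have "pi03_in (top_of_set {0..1}) (topspace (top_of_set {0..1}) \<inter> (\<Inter>w\<in>{w. length w \<ge> 1}. S w))"
    by (intro pi03_in_INT) auto
  also have "topspace (top_of_set {0..1}) \<inter> (\<Inter>w\<in>{w. length w \<ge> 1}. S w) = Normal"
  proof -
    have "S w \<subseteq> unique_expansion" for w by (auto simp: S_def)
    \<comment> \<open>An empty index set would give the whole space; one nonempty word keeps the
      intersection inside \<open>unique_expansion\<close>.\<close>
    moreover have "[True] \<in> {w. length w \<ge> 1}" by simp
    ultimately have "(\<Inter>w\<in>{w. length w \<ge> 1}. S w) \<subseteq> unique_expansion" by blast
    moreover have "Normal \<subseteq> unique_expansion" by (auto simp: Normal_def unique_expansion_def)
    moreover have "y \<in> (\<Inter>w\<in>{w. length w \<ge> 1}. S w) \<longleftrightarrow> y \<in> Normal" if y: "y \<in> unique_expansion" for y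
    proof -
      obtain x where x: "binary_expansion x y" "\<And>x'. binary_expansion x' y \<Longrightarrow> x' = x"
        using y unfolding unique_expansion_def by blast
      have "(\<exists>x'. binary_expansion x' y \<and> \<phi> x') \<longleftrightarrow> \<phi> x" for \<phi> using x by blast
      then show ?thesis
        using y by (auto simp: S_def Normal_def normal_seq_def unique_expansion_def)
    qed
    moreover have "unique_expansion \<subseteq> {0..1}" by (auto simp: unique_expansion_def)
    ultimately have "{0..1} \<inter> (\<Inter>w\<in>{w. length w \<ge> 1}. S w) = Normal" by blast
    then show ?thesis by simp
  qed
  finally show ?thesis .
qed

lemma D2_pi03_diffs:
  "D2 (pi03_in (top_of_set {0..1})) (TpcN - Normal)"
  "D2 (pi03_in (top_of_set {0..1})) (Normal - TpcN)"
  unfolding D2_def using pi03_in_TpcN pi03_in_Normal by blast+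

subsection \<open>Guessing membership from prefixes\<close>

text \<open>Packs infinitely many stabilization requirements into one divergence: a value
  \<open>k\<close> is attained at some \<open>s > k\<close> only if \<open>g k\<close> changes
  there. The cap \<open>k \<ge> s\<close> makes the minimum exist and itself tends to
  infinity.\<close>

lemma filterlim_least_change_iff:
  fixes g :: "nat \<Rightarrow> nat \<Rightarrow> nat"
  shows "filterlim (\<lambda>s. LEAST k. k \<ge> s \<or> g k s \<noteq> g k (s - 1)) at_top sequentially \<longleftrightarrow>
    (\<forall>k. \<forall>\<^sub>F s in sequentially. g k s = g k (s - 1))" (is "filterlim ?p _ _ \<longleftrightarrow> ?R")
proof
  assume L: "filterlim ?p at_top sequentially"
  show ?R
  proof
    fix k
    have "\<forall>\<^sub>F s in sequentially. ?p s \<ge> Suc k"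
      using L by (simp add: filterlim_at_top)
    then show "\<forall>\<^sub>F s in sequentially. g k s = g k (s - 1)"
    proof eventually_elim
      case (elim s)
      then show ?case using not_less_Least[of k "\<lambda>k. k \<ge> s \<or> g k s \<noteq> g k (s - 1)"] by auto
    qed
  qed
next
  assume R: ?R
  show "filterlim ?p at_top sequentially"
    unfolding filterlim_at_top
  proof
    fix K
    have "\<forall>\<^sub>F s in sequentially. \<forall>k\<in>{..<K}. g k s = g k (s - 1)"
      using R by (intro eventually_ball_finite) auto
    then show "\<forall>\<^sub>F s in sequentially. K \<le> ?p s"
      using eventually_ge_at_top[of K]
    proof eventually_elim
      case (elim s)
      have "?p s \<ge> s \<or> g (?p s) s \<noteq> g (?p s) (s - 1)"
        by (rule LeastI[of "\<lambda>k. k \<ge> s \<or> g k s \<noteq> g k (s - 1)" s]) simp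
      then show ?case using elim by (meson lessThan_iff not_le order.trans)
    qed
  qed
qed

lemma mono_nat_bounded_iff_eventually_const:
  fixes g :: "nat \<Rightarrow> nat"
  assumes "mono g"
  shows "(\<exists>b. \<forall>s. g s \<le> b) \<longleftrightarrow> (\<forall>\<^sub>F s in sequentially. g s = g (s - 1))"
proof
  assume "\<exists>b. \<forall>s. g s \<le> b"
  then obtain b where b: "\<And>s. g s \<le> b" by blast
  then have fin: "finite (range g)" by (intro finite_subset[of "range g" "{..b}"]) auto
  then have "Max (range g) \<in> range g" by (intro Max_in) auto
  then obtain s0 where s0: "g s0 = Max (range g)" by (metis rangeE)
  have const: "g s = g s0" if "s \<ge> s0" for s
  proof (rule antisym)
    show "g s \<le> g s0" unfolding s0 using fin by simp
    show "g s0 \<le> g s" using that assms by (simp add: monoD)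
  qed
  show "\<forall>\<^sub>F s in sequentially. g s = g (s - 1)"
    using eventually_ge_at_top[of "Suc s0"]
  proof eventually_elim
    case (elim s)
    then have "s - 1 \<ge> s0" "s \<ge> s0" by auto
    then show ?case using const by metis
  qed
next
  assume "\<forall>\<^sub>F s in sequentially. g s = g (s - 1)"
  then obtain s0 where s0: "\<And>s. s \<ge> s0 \<Longrightarrow> g s = g (s - 1)"
    by (auto simp: eventually_sequentially)
  have "g (s0 + d) = g s0" for d
    by (induction d) (use s0 in \<open>auto simp: le_Suc_eq\<close>)
  then have "g s \<le> g s0" for s
    using monoD[OF assms, of s "s0 + s"] by simp
  then show "\<exists>b. \<forall>s. g s \<le> b" by blast
qed

lemma pi03_in_unit_intervalD:
  assumes "pi03_in (top_of_set {0..1::real}) A"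
  shows "\<exists>C :: nat \<Rightarrow> nat \<Rightarrow> real set. (\<forall>k n. closed (C k n)) \<and> A = {y \<in> {0..1}. \<forall>k. \<exists>n. y \<in> C k n}"
proof -
  obtain S where S: "\<And>k::nat. fsigma_in (top_of_set {0..1}) (S k)"
    "A = topspace (top_of_set {0..1}) \<inter> (\<Inter>k. S k)"
    using pi03_inE[OF assms] by metis
  have "\<exists>C. (\<forall>n::nat. closed (C n)) \<and> S k = \<Union>(range C)" for k
  proof -
    obtain C where "\<And>n::nat. closedin (top_of_set {0..1}) (C n)" "\<Union>(range C) = S k"
      using S(1)[of k] unfolding fsigma_in_ascending by blast
    then show ?thesis using closedin_closed_trans[OF _ closed_real_atLeastAtMost] by metis
  qed
  then obtain C where C: "\<And>k (n::nat). closed (C k n)" "\<And>k. S k = \<Union>(range (C k))" by metis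
  then have "A = {y \<in> {0..1}. \<forall>k. \<exists>n. y \<in> C k n}" unfolding S(2) by auto
  with C(1) show ?thesis by blast
qed

text \<open>The cells shrink to \<open>y\<close>, so points of \<open>C\<close> chosen in them
  converge to \<open>y\<close>. Failure of membership thus becomes visible on a finite
  prefix.\<close>

lemma mem_closed_iff_meets_cells:
  assumes "closed C" "binary_expansion x y"
  shows "y \<in> C \<longleftrightarrow> (\<forall>s. C \<inter> {prefix_value x s..prefix_value x s + 1 / 2 ^ s} \<noteq> {})"
proof
  assume "y \<in> C"
  then show "\<forall>s. C \<inter> {prefix_value x s..prefix_value x s + 1 / 2 ^ s} \<noteq> {}"
    using binary_expansion_ge[OF assms(2)] binary_expansion_le[OF assms(2)] by fastforce
next
  assume "\<forall>s. C \<inter> {prefix_value x s..prefix_value x s + 1 / 2 ^ s} \<noteq> {}"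
  then have "\<forall>s. \<exists>c. c \<in> C \<and> prefix_value x s \<le> c \<and> c \<le> prefix_value x s + 1 / 2 ^ s" by force
  then obtain c where c: "\<And>s. c s \<in> C" "\<And>s. prefix_value x s \<le> c s"
    "\<And>s. c s \<le> prefix_value x s + 1 / 2 ^ s" by metis
  have lim: "prefix_value x \<longlonglongrightarrow> y"
    using assms(2) by (simp add: binary_expansion_iff_tendsto)
  have "c \<longlonglongrightarrow> y"
    by (rule tendsto_sandwich[OF _ _ lim tendsto_prefix_value_upper[OF lim]]) (use c in auto)
  with assms(1) c(1) show "y \<in> C" by (rule closed_sequentially)
qed

text \<open>For each requirement \<open>k\<close>, candidates \<open>n\<close> are tried in
  increasing order; a wrong one is refuted by some prefix because \<open>C k n\<close> is closed.
  The claim ranges over sequences, the objects among which a fixed point is sought later.\<close>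

lemma pi03_prefix_reduction:
  assumes "pi03_in (top_of_set {0..1}) A"
  shows "\<exists>P :: (nat \<Rightarrow> bool) \<Rightarrow> nat \<Rightarrow> nat. determined_by_prefix P \<and>
    (\<forall>x. bin_val x \<in> A \<longleftrightarrow> filterlim (P x) at_top sequentially)"
proof -
  obtain C where C: "\<And>k n. closed (C k n)" "A = {y \<in> {0..1}. \<forall>k::nat. \<exists>n::nat. y \<in> C k n}"
    using pi03_in_unit_intervalD[OF assms] by blast
  define cell where "cell x s = {prefix_value x s..prefix_value x s + 1 / 2 ^ s}" for x s
  \<comment> \<open>\<open>g x k s\<close> is the current guess for an \<open>n\<close> with \<open>bin_val x \<in> C k n\<close>. It never decreases, and
    it stabilizes iff such an \<open>n\<close> exists; \<open>P x s\<close> is the first index whose guess has just changed.\<close>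
  define g where "g x k s = (LEAST n. n \<ge> s \<or> C k n \<inter> cell x s \<noteq> {})" for x and k s :: nat
  define P where "P x s = (LEAST k. k \<ge> s \<or> g x k s \<noteq> g x k (s - 1))" for x and s :: nat
  have g: "g x k s \<ge> s \<or> C k (g x k s) \<inter> cell x s \<noteq> {}" for x k s
    unfolding g_def by (rule LeastI[where k = s]) simp
  have g_le: "g x k s \<le> n" if "n \<ge> s \<or> C k n \<inter> cell x s \<noteq> {}" for x k s n
    unfolding g_def using that by (rule Least_le)
  have cell_anti: "cell x (Suc s) \<subseteq> cell x s" for x s
    using incseqD[OF incseq_prefix_value, of s "Suc s" x] decseqD[OF decseq_prefix_value, of s "Suc s" x]
    unfolding cell_def by (intro atLeastatMost_subset_iff[THEN iffD2] disjI2 conjI) (blast intro: le_SucI)+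
  have g_mono: "mono (g x k)" for x k
  proof (rule incseq_SucI)
    fix s show "g x k s \<le> g x k (Suc s)"
      using g[where s = "Suc s" and x = x and k = k] cell_anti[of x s] by (intro g_le) auto
  qed
  have bounded: "(\<exists>b. \<forall>s. g x k s \<le> b) \<longleftrightarrow> (\<exists>n. bin_val x \<in> C k n)" for x k
  proof
    assume "\<exists>n. bin_val x \<in> C k n"
    then obtain n where "bin_val x \<in> C k n" by blast
    then have "C k n \<inter> cell x s \<noteq> {}" for s
      using mem_closed_iff_meets_cells[OF C(1) binary_expansion_bin_val] unfolding cell_def by blast
    then show "\<exists>b. \<forall>s. g x k s \<le> b" using g_le by blast
  next
    assume b: "\<exists>b. \<forall>s. g x k s \<le> b"
    then obtain b where b': "\<And>s. g x k s \<le> b" by blast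
    from b obtain s0 where s0: "\<And>s. s \<ge> s0 \<Longrightarrow> g x k s = g x k (s - 1)"
      unfolding mono_nat_bounded_iff_eventually_const[OF g_mono] eventually_sequentially by blast
    have const: "g x k (s0 + d) = g x k s0" for d
      by (induction d) (use s0 in \<open>auto simp: le_Suc_eq\<close>)
    \<comment> \<open>From \<open>m\<close> on, the cap \<open>n \<ge> s\<close> in \<open>g\<close>
      exceeds the bound \<open>b\<close>, so the stable guess must really meet the cell.\<close>
    define m where "m = s0 + Suc b"
    have "C k (g x k s0) \<inter> cell x s \<noteq> {}" for s
    proof -
      have "C k (g x k s0) \<inter> cell x (m + s) \<noteq> {}"
        using g[where s = "m + s" and x = x and k = k] b'[of "m + s"] const[of "Suc b + s"]
        by (auto simp: m_def add.assoc)
      moreover have "cell x (m + s) \<subseteq> cell x s"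
        using lift_Suc_antimono_le[of "cell x" s "m + s"] cell_anti by simp
      ultimately show ?thesis by blast
    qed
    then show "\<exists>n. bin_val x \<in> C k n"
      using mem_closed_iff_meets_cells[OF C(1) binary_expansion_bin_val] unfolding cell_def by blast
  qed
  show ?thesis
  proof (intro exI[of _ P] conjI allI)
    show "determined_by_prefix P"
      unfolding determined_by_prefix_def
    proof (intro allI impI)
      fix x x' :: "nat \<Rightarrow> bool" and s assume eq: "\<forall>i<s. x i = x' i"
      have "g x k t = g x' k t" if "t \<le> s" for t k
        using eq that prefix_value_cong[of t x x'] unfolding g_def cell_def by simp
      then show "P x s = P x' s" unfolding P_def by simp
    qed
    show "bin_val x \<in> A \<longleftrightarrow> filterlim (P x) at_top sequentially" for x
      unfolding P_def filterlim_least_change_iff mono_nat_bounded_iff_eventually_const[OF g_mono, symmetric]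
        bounded C(2) using binary_expansion_bounds[OF binary_expansion_bin_val, of x] by simp
  qed
qed

subsection \<open>A normal sequence divided into stages\<close>

text \<open>Stage \<open>s\<close> has \<open>2 ^ s\<close> blocks of length \<open>s + 2\<close>.
  With two separating zeros per block, the lengths of the earlier stages add up to exactly
  \<open>s * 2 ^ s\<close>.\<close>

definition stage_start :: "nat \<Rightarrow> nat" where
  "stage_start s = s * 2 ^ s"

definition stage :: "nat \<Rightarrow> nat" where
  "stage i = (LEAST s. i < stage_start (Suc s))"

lemma stage_start_Suc: "stage_start (Suc s) = stage_start s + (s + 2) * 2 ^ s"
  by (simp add: stage_start_def algebra_simps)

lemma strict_mono_stage_start: "strict_mono stage_start"
  by (rule strict_mono_Suc_iff[THEN iffD2]) (simp add: stage_start_Suc)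

lemma stage_start_mono: "s \<le> t \<Longrightarrow> stage_start s \<le> stage_start t"
  using strict_mono_stage_start by (simp add: strict_mono_less_eq)

lemma stage_start_ge: "s \<le> stage_start s"
  by (simp add: stage_start_def)

lemma stage_eqI: "stage_start s \<le> i \<Longrightarrow> i < stage_start (Suc s) \<Longrightarrow> stage i = s"
  unfolding stage_def
proof (rule Least_equality)
  fix t assume "stage_start s \<le> i" "i < stage_start (Suc t)"
  then have "stage_start s < stage_start (Suc t)" by simp
  then show "s \<le> t" using strict_mono_stage_start by (simp add: strict_mono_less)
qed

lemma less_stage_start_Suc_stage: "i < stage_start (Suc (stage i))"
  unfolding stage_def
  by (rule LeastI[of "\<lambda>s. i < stage_start (Suc s)" i]) (use stage_start_ge[of "Suc i"] in simp)

lemma stage_start_stage_le: "stage_start (stage i) \<le> i"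
proof (cases "stage i")
  case 0
  then show ?thesis by (simp add: stage_start_def)
next
  case (Suc t)
  then have "\<not> i < stage_start (Suc t)"
    unfolding stage_def by (metis lessI not_less_Least)
  with Suc show ?thesis by simp
qed

text \<open>The Galois connection that turns bounds on positions into bounds on stages and
  back.\<close>

lemma le_stage_iff: "s \<le> stage i \<longleftrightarrow> stage_start s \<le> i"
proof
  assume "s \<le> stage i"
  then show "stage_start s \<le> i"
    using stage_start_mono[of s "stage i"] stage_start_stage_le[of i] by simp
next
  assume "stage_start s \<le> i"
  then have "stage_start s < stage_start (Suc (stage i))"
    using less_stage_start_Suc_stage[of i] by simp
  then show "s \<le> stage i"
    using strict_mono_stage_start by (simp add: strict_mono_less)
qed

lemma filterlim_stage: "filterlim stage at_top sequentially"
  unfolding filterlim_at_top le_stage_iff by (simp add: eventually_ge_at_top)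

lemma filterlim_stage_start: "filterlim stage_start at_top sequentially"
  using strict_mono_stage_start by (rule filterlim_subseq)

lemma stageE:
  obtains s j where "i = stage_start s + j" "j < (s + 2) * 2 ^ s" "stage i = s"
proof
  show "i = stage_start (stage i) + (i - stage_start (stage i))"
    using stage_start_stage_le[of i] by simp
  show "i - stage_start (stage i) < (stage i + 2) * 2 ^ stage i"
    using stage_start_stage_le[of i] less_stage_start_Suc_stage[of i] by (simp add: stage_start_Suc)
qed simp

lemma stage_add [simp]: "j < (s + 2) * 2 ^ s \<Longrightarrow> stage (stage_start s + j) = s"
  by (rule stage_eqI) (simp_all add: stage_start_Suc)

text \<open>Block \<open>w\<close> of stage \<open>s\<close> spells the number \<open>w\<close>,
  least significant bit first. Numerical order makes the digits at a fixed offset periodic in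
  \<open>w\<close>.\<close>

definition base :: "nat \<Rightarrow> bool" where
  "base i = (let s = stage i; j = i - stage_start s; t = j mod (s + 2)
    in t < s \<and> bit (j div (s + 2)) t)"

lemma base_stage:
  assumes "w < 2 ^ s" "t < s + 2"
  shows "base (stage_start s + (w * (s + 2) + t)) \<longleftrightarrow> t < s \<and> bit w t"
proof -
  have "w * (s + 2) + t < Suc w * (s + 2)" using assms by simp
  also have "\<dots> \<le> 2 ^ s * (s + 2)" using assms by (intro mult_right_mono) auto
  finally have "stage (stage_start s + (w * (s + 2) + t)) = s" by (intro stage_add) (simp only: mult.commute)
  moreover have "(w * (s + 2) + t) mod (s + 2) = t" "(w * (s + 2) + t) div (s + 2) = w"
    using assms by (auto simp only: mod_mult_self3 mod_less div_mult_self3 div_less)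
  ultimately show ?thesis unfolding base_def Let_def by simp
qed

section \<open>Counting words by starting position\<close>

definition matches :: "(nat \<Rightarrow> bool) \<Rightarrow> bool list \<Rightarrow> nat \<Rightarrow> bool" where
  "matches x v i \<longleftrightarrow> (\<forall>j<length v. x (i + j) = v ! j)"

text \<open>The word may run past position \<open>n\<close>, so that the count is a plain sum over
  starting positions; limit frequencies are the same by
  \<open>occurrences_ratio_iff\<close>.\<close>

definition match_count :: "(nat \<Rightarrow> bool) \<Rightarrow> bool list \<Rightarrow> nat \<Rightarrow> nat" where
  "match_count x v n = card {i. i < n \<and> matches x v i}"

lemma sum_matches: "(\<Sum>i<n. of_bool (matches x v i)) = real (match_count x v n)"
  unfolding match_count_def by (simp add: of_bool_def sum.If_cases Int_def)

lemma occurrences_match_count: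
  "occurrences x v n \<le> match_count x v n + 1" "match_count x v n \<le> occurrences x v n + length v"
proof -
  let ?O = "{i. i + length v \<le> n \<and> matches x v i}"
  let ?M = "{i. i < n \<and> matches x v i}"
  have O: "occurrences x v n = card ?O" by (simp add: occurrences_def matches_def)
  have fin: "finite ?O" "finite ?M"
    by (rule finite_subset[of _ "{..n}"]; auto)+
  \<comment> \<open>The additional position \<open>n\<close> accounts for the empty word, which also
    occurs there.\<close>
  have "card ?O \<le> card (insert n ?M)"
    using fin by (intro card_mono) auto
  also have "\<dots> \<le> card ?M + 1" by (simp add: card_insert_if fin)
  finally show "occurrences x v n \<le> match_count x v n + 1" by (simp add: O match_count_def)
  have "card ?M \<le> card (?O \<union> {n - length v..<n})"
    using fin by (intro card_mono) auto
  also have "\<dots> \<le> card ?O + card {n - length v..<n}" by (rule card_Un_le)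
  also have "\<dots> \<le> card ?O + length v" by simp
  finally show "match_count x v n \<le> occurrences x v n + length v" by (simp add: O match_count_def)
qed

lemma occurrences_ratio_iff:
  "(\<lambda>n. real (occurrences x v n) / real n) \<longlonglongrightarrow> c \<longleftrightarrow>
   (\<lambda>n. real (match_count x v n) / real n) \<longlonglongrightarrow> c"
proof (rule Lim_transform_eq)
  show "(\<lambda>n. real (occurrences x v n) / real n - real (match_count x v n) / real n) \<longlonglongrightarrow> 0"
  proof (rule Lim_null_comparison)
    have "\<bar>real (occurrences x v n) - real (match_count x v n)\<bar> \<le> real (length v) + 1" for n
      using occurrences_match_count[of x v n] by linarith
    then show "\<forall>\<^sub>F n in sequentially. norm (real (occurrences x v n) / real n -
        real (match_count x v n) / real n) \<le> (real (length v) + 1) / real n"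
      by (simp add: diff_divide_distrib[symmetric] divide_right_mono)
  qed real_asymp
qed

text \<open>Full periods cancel, and fewer than \<open>p\<close> terms of absolute value at most 1
  remain.\<close>

lemma abs_sum_periodic_le:
  fixes g :: "nat \<Rightarrow> real"
  assumes period: "\<And>w. g (w + p) = g w" and zero: "(\<Sum>w<p. g w) = 0"
    and bound: "\<And>w. \<bar>g w\<bar> \<le> 1" and "p > 0"
  shows "\<bar>\<Sum>w<n. g w\<bar> \<le> p"
proof -
  have per: "g (w + k * p) = g w" for k w
  proof (induction k)
    case (Suc k)
    have "g (w + Suc k * p) = g ((w + k * p) + p)" by (simp add: add_ac)
    then show ?case using period Suc by simp
  qed simp
  have full: "(\<Sum>w<k * p. g w) = 0" for k
  proof -
    have "(\<Sum>w\<in>{i * p..<i * p + p}. g w) = 0" for i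
      using sum.shift_bounds_nat_ivl[of g 0 "i * p" p] zero
      by (simp add: per lessThan_atLeast0 add.commute[of p])
    then show ?thesis by (simp add: sum.nat_group[symmetric])
  qed
  have "(\<Sum>w<n. g w) = (\<Sum>w<(n div p) * p + n mod p. g w)" by simp
  also have "\<dots> = (\<Sum>w<(n div p) * p. g w) + (\<Sum>w\<in>{(n div p) * p..<(n div p) * p + n mod p}. g w)"
    by (subst sum.atLeastLessThan_concat[of 0, symmetric, unfolded atLeast0LessThan]) auto
  also have "(\<Sum>w\<in>{(n div p) * p..<(n div p) * p + n mod p}. g w) = (\<Sum>w<n mod p. g w)"
    using sum.shift_bounds_nat_ivl[of g 0 "(n div p) * p" "n mod p"]
    by (simp add: per lessThan_atLeast0 add.commute[of p])
  finally have "\<bar>\<Sum>w<n. g w\<bar> = \<bar>\<Sum>w<n mod p. g w\<bar>" by (simp add: full)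
  also have "\<dots> \<le> (\<Sum>w<n mod p. 1)" by (intro order.trans[OF sum_abs] sum_mono bound)
  also have "\<dots> \<le> p" using \<open>p > 0\<close> by (simp add: less_imp_le)
  finally show ?thesis .
qed

lemma ex1_bits_nat:
  "\<exists>!h::nat. h < 2 ^ length v \<and> (\<forall>j<length v. bit h j = v ! j)"
proof (rule ex1I)
  let ?h = "horner_sum of_bool 2 v :: nat"
  show h: "?h < 2 ^ length v \<and> (\<forall>j<length v. bit ?h j = v ! j)"
    using horner_sum_of_bool_2_less[of v] by (auto simp: bit_horner_sum_bit_iff)
  fix h :: nat assume h': "h < 2 ^ length v \<and> (\<forall>j<length v. bit h j = v ! j)"
  have "take_bit (length v) h = take_bit (length v) ?h"
  proof (rule bit_eqI)
    fix j
    show "bit (take_bit (length v) h) j = bit (take_bit (length v) ?h) j"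
      using h h' unfolding bit_take_bit_iff by blast
  qed
  then show "h = ?h" using h h' by (simp add: take_bit_nat_eq_self)
qed

text \<open>Only \<open>length v\<close> bits of \<open>w\<close> from bit \<open>t\<close> on
  matter, whence the period \<open>2 ^ (t + length v)\<close>. Over a period these bits take every
  value \<open>h\<close> equally often and exactly one \<open>h\<close> spells \<open>v\<close>, so
  the centred sum over a period is zero.\<close>

lemma sum_word_matches:
  fixes v :: "bool list" and t :: nat
  defines "g \<equiv> \<lambda>w::nat. of_bool (\<forall>j<length v. bit w (t + j) = v ! j) - 1 / 2 ^ length v :: real"
  shows "\<bar>\<Sum>w<n. g w\<bar> \<le> 2 ^ (t + length v)"
proof -
  define f where "f h = (of_bool (\<forall>j<length v. bit h j = v ! j) - 1 / 2 ^ length v :: real)" for h :: nat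
  have gf: "g w = f (w div 2 ^ t)" for w
    by (simp add: g_def f_def bit_drop_bit_eq drop_bit_eq_div[symmetric])
  have "(\<Sum>w<2 ^ length v * 2 ^ t. g w) = (\<Sum>h<2 ^ length v. \<Sum>w\<in>{h * 2 ^ t..<h * 2 ^ t + 2 ^ t}. g w)"
    by (rule sum.nat_group[symmetric])
  also have "\<dots> = (\<Sum>h<2 ^ length v. 2 ^ t * f h)"
  proof (rule sum.cong[OF refl])
    fix h :: nat
    have "(\<Sum>w\<in>{h * 2 ^ t..<h * 2 ^ t + 2 ^ t}. g w) = (\<Sum>w\<in>{h * 2 ^ t..<h * 2 ^ t + 2 ^ t}. f h)"
      by (rule sum.cong) (auto simp: gf add.commute mult.commute intro!: arg_cong[of _ _ f] div_nat_eqI)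
    then show "(\<Sum>w\<in>{h * 2 ^ t..<h * 2 ^ t + 2 ^ t}. g w) = 2 ^ t * f h" by simp
  qed
  also have "\<dots> = 2 ^ t * (\<Sum>h<2 ^ length v. f h)" by (simp add: sum_distrib_left)
  also have "(\<Sum>h<2 ^ length v. f h) = 0"
  proof -
    obtain u where "{h::nat. h < 2 ^ length v \<and> (\<forall>j<length v. bit h j = v ! j)} = {u}"
      using ex1_bits_nat[of v] by auto
    then have "(\<Sum>h<2 ^ length v. of_bool (\<forall>j<length v. bit (h::nat) j = v ! j) :: real) = 1"
      by (simp add: of_bool_def sum.If_cases Int_def)
    then show ?thesis by (simp add: f_def sum_subtractf)
  qed
  finally have zero: "(\<Sum>w<2 ^ (t + length v). g w) = 0" by (simp add: power_add mult.commute)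
  have "\<bar>\<Sum>w<n. g w\<bar> \<le> real (2 ^ (t + length v))"
  proof (rule abs_sum_periodic_le[OF _ zero])
    fix w
    show "g (w + 2 ^ (t + length v)) = g w"
    proof -
      have "bit (w + 2 ^ (t + length v)) (t + j) = bit w (t + j)" if "j < length v" for j
      proof -
        have "take_bit (t + length v) (w + 2 ^ (t + length v)) = take_bit (t + length v) w"
          by (simp add: take_bit_eq_mod)
        then show ?thesis using that by (metis bit_take_bit_iff add_less_cancel_left)
      qed
      then show ?thesis by (simp add: g_def)
    qed
    show "\<bar>g w\<bar> \<le> 1" by (simp add: g_def of_bool_def)
  qed simp
  then show ?thesis by simp
qed

lemma sum_lessThan_mult:
  "(\<Sum>i<n * k. f i) = (\<Sum>w<n. \<Sum>t<k. f (w * k + t :: nat))"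
proof -
  have "(\<Sum>i\<in>{w * k..<w * k + k}. f i) = (\<Sum>t<k. f (w * k + t))" for w
    using sum.shift_bounds_nat_ivl[of f 0 "w * k" k] by (simp add: add.commute lessThan_atLeast0)
  then show ?thesis by (simp add: sum.nat_group[symmetric])
qed

lemma sum_lessThan_add:
  "(\<Sum>i<n + k. f i) = (\<Sum>i<n. f i) + (\<Sum>i<k. f (n + i :: nat))"
  by (induction k) (simp_all add: add.assoc)

definition discrepancy :: "(nat \<Rightarrow> bool) \<Rightarrow> bool list \<Rightarrow> nat \<Rightarrow> real" where
  "discrepancy x v i = of_bool (matches x v i) - 1 / 2 ^ length v"

lemma abs_discrepancy_le: "\<bar>discrepancy x v i\<bar> \<le> 1"
  by (simp add: discrepancy_def of_bool_def)

lemma abs_sum_discrepancy_le: "\<bar>\<Sum>i<n. discrepancy x v (f i)\<bar> \<le> real n"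
proof -
  have "(\<Sum>i<n. \<bar>discrepancy x v (f i)\<bar>) \<le> (\<Sum>i<n. 1)" by (intro sum_mono abs_discrepancy_le)
  then have "(\<Sum>i<n. \<bar>discrepancy x v (f i)\<bar>) \<le> real n" by simp
  with sum_abs[of "\<lambda>i. discrepancy x v (f i)" "{..<n}"] show ?thesis by (rule order.trans)
qed

lemma base_matches_word:
  assumes "w < 2 ^ s" "t + length v \<le> s"
  shows "matches base v (stage_start s + (w * (s + 2) + t)) \<longleftrightarrow> (\<forall>j<length v. bit w (t + j) = v ! j)"
proof -
  have "base (stage_start s + (w * (s + 2) + t) + j) = bit w (t + j)" if "j < length v" for j
    using base_stage[of w s "t + j"] assms that by (simp add: add.assoc)
  then show ?thesis unfolding matches_def by simp
qed

text \<open>The stage is summed by offset \<open>t\<close> inside the blocks. Offsets where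
  \<open>v\<close> fits into the word contribute a geometric series, at most
  \<open>2 * 2 ^ s\<close>; the other offsets, at most \<open>length v + 1\<close> many, contribute
  at most \<open>2 ^ s\<close> each; the incomplete last block contributes at most
  \<open>2 * 2 ^ s\<close>.\<close>

lemma base_stage_discrepancy:
  assumes "J \<le> (s + 2) * 2 ^ s"
  shows "\<bar>\<Sum>j<J. discrepancy base v (stage_start s + j)\<bar> \<le> (real (length v) + 5) * 2 ^ s"
proof -
  let ?m = "length v"
  define F where "F j = discrepancy base v (stage_start s + j)" for j
  define W where "W = J div (s + 2)"
  define r where "r = J mod (s + 2)"
  have J: "J = W * (s + 2) + r" unfolding W_def r_def by (rule div_mult_mod_eq[symmetric])
  have "W * (s + 2) \<le> 2 ^ s * (s + 2)" using assms J by (simp add: mult.commute)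
  then have W: "W \<le> 2 ^ s" by (metis mult_le_cancel2 add_2_eq_Suc' zero_less_Suc)
  have "r < s + 2" by (simp add: r_def)
  moreover have "s + 2 \<le> 2 * 2 ^ s" by (induction s) auto
  ultimately have r: "r \<le> 2 * 2 ^ s" by linarith
  have column: "\<bar>\<Sum>w<W. F (w * (s + 2) + t)\<bar> \<le> (if t + ?m \<le> s then 2 ^ (t + ?m) else 0) + (if t + ?m \<le> s then 0 else 2 ^ s)"
    if "t < s + 2" for t
  proof (cases "t + ?m \<le> s")
    case True
    have "(\<Sum>w<W. F (w * (s + 2) + t)) =
      (\<Sum>w<W. of_bool (\<forall>j<?m. bit w (t + j) = v ! j) - 1 / 2 ^ ?m)"
    proof (rule sum.cong[OF refl])
      fix w assume "w \<in> {..<W}"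
      then have "w < 2 ^ s" using W by simp
      then show "F (w * (s + 2) + t) = of_bool (\<forall>j<?m. bit w (t + j) = v ! j) - 1 / 2 ^ ?m"
        unfolding F_def discrepancy_def by (simp only: base_matches_word[OF _ True])
    qed
    then show ?thesis using sum_word_matches[of v t W] True by simp
  next
    case False
    have "\<bar>\<Sum>w<W. F (w * (s + 2) + t)\<bar> \<le> real W"
      unfolding F_def by (rule abs_sum_discrepancy_le)
    also have "\<dots> \<le> 2 ^ s" using W by (metis of_nat_le_iff of_nat_numeral of_nat_power)
    finally show ?thesis using False by simp
  qed
  have inner: "(\<Sum>t<s + 2. if t + ?m \<le> s then 2 ^ (t + ?m) else 0 :: real) \<le> 2 * 2 ^ s"
  proof -
    have "(\<Sum>t<s + 2. if t + ?m \<le> s then 2 ^ (t + ?m) else 0 :: real) =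
        (\<Sum>t\<in>{t \<in> {..<s + 2}. t + ?m \<le> s}. 2 ^ (t + ?m))"
      by (rule sum.inter_filter[symmetric]) simp
    also have "\<dots> = (\<Sum>u\<in>(\<lambda>t. t + ?m) ` {t \<in> {..<s + 2}. t + ?m \<le> s}. 2 ^ u)"
      by (subst sum.reindex) (auto simp: inj_on_def)
    also have "\<dots> \<le> (\<Sum>u<Suc s. 2 ^ u)"
      by (rule sum_mono2) auto
    also have "\<dots> \<le> 2 * 2 ^ s" unfolding sum_power2 by (induction s) simp_all
    finally show ?thesis .
  qed
  have outer: "(\<Sum>t<s + 2. if t + ?m \<le> s then 0 else 2 ^ s :: real) \<le> (real ?m + 1) * 2 ^ s"
  proof -
    have "card {t \<in> {..<s + 2}. \<not> t + ?m \<le> s} \<le> card {s + 1 - ?m..<s + 2}"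
      by (rule card_mono) auto
    also have "\<dots> \<le> ?m + 1" by simp
    finally have "real (card {t \<in> {..<s + 2}. \<not> t + ?m \<le> s}) \<le> real ?m + 1" by linarith
    moreover have "(\<Sum>t<s + 2. if t + ?m \<le> s then 0 else 2 ^ s :: real) =
        (\<Sum>t\<in>{t \<in> {..<s + 2}. \<not> t + ?m \<le> s}. 2 ^ s)"
      by (subst sum.inter_filter) (auto intro: sum.cong)
    ultimately show ?thesis by (simp add: mult_right_mono)
  qed
  have "\<bar>\<Sum>i<W * (s + 2). F i\<bar> = \<bar>\<Sum>t<s + 2. \<Sum>w<W. F (w * (s + 2) + t)\<bar>"
    by (subst sum_lessThan_mult, subst sum.swap) simp
  also have "\<dots> \<le> (\<Sum>t<s + 2. \<bar>\<Sum>w<W. F (w * (s + 2) + t)\<bar>)" by (rule sum_abs)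
  also have "\<dots> \<le> (\<Sum>t<s + 2. (if t + ?m \<le> s then 2 ^ (t + ?m) else 0) + (if t + ?m \<le> s then 0 else 2 ^ s))"
    by (rule sum_mono) (use column in simp)
  also have "\<dots> \<le> 2 * 2 ^ s + (real ?m + 1) * 2 ^ s"
    unfolding sum.distrib using inner outer by linarith
  finally have main: "\<bar>\<Sum>i<W * (s + 2). F i\<bar> \<le> 2 * 2 ^ s + (real ?m + 1) * 2 ^ s" .
  have "\<bar>\<Sum>i<r. F (W * (s + 2) + i)\<bar> \<le> real r"
    unfolding F_def by (rule abs_sum_discrepancy_le)
  also have "\<dots> \<le> 2 * 2 ^ s" using r by (metis of_nat_le_iff of_nat_mult of_nat_numeral of_nat_power)
  finally have "\<bar>\<Sum>i<r. F (W * (s + 2) + i)\<bar> \<le> 2 * 2 ^ s" .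
  with main show ?thesis
    unfolding F_def[symmetric] J sum_lessThan_add by (simp add: algebra_simps abs_le_iff)
qed

text \<open>The bounds for the earlier stages form a geometric series, dominated by one more copy of
  the bound for stage \<open>s\<close>.\<close>

lemma base_discrepancy:
  assumes "j \<le> (s + 2) * 2 ^ s"
  shows "\<bar>\<Sum>i<stage_start s + j. discrepancy base v i\<bar> \<le> 2 * (real (length v) + 5) * 2 ^ s"
proof -
  have *: "\<bar>\<Sum>i<stage_start s. discrepancy base v i\<bar> \<le> (real (length v) + 5) * 2 ^ s" for s
  proof (induction s)
    case 0
    then show ?case by (simp add: stage_start_def)
  next
    case (Suc s)
    then show ?case
      unfolding stage_start_Suc sum_lessThan_add
      using base_stage_discrepancy[of "(s + 2) * 2 ^ s" s v] by (simp add: algebra_simps abs_le_iff)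
  qed
  show ?thesis
    unfolding sum_lessThan_add
    using *[of s] base_stage_discrepancy[OF assms, of v] by (simp add: algebra_simps abs_le_iff)
qed

text \<open>A position in stage \<open>s\<close> is at least \<open>s * 2 ^ s\<close>; the factor
  \<open>s\<close> makes a discrepancy of order \<open>2 ^ s\<close> negligible.\<close>

lemma power_stage_over_index: "(\<lambda>n. 2 ^ stage n / real n) \<longlonglongrightarrow> 0"
proof (rule Lim_null_comparison)
  show "\<forall>\<^sub>F n in sequentially. norm (2 ^ stage n / real n) \<le> 1 / real (stage n)"
    using eventually_ge_at_top[of "stage_start 1"]
  proof eventually_elim
    case (elim n)
    then have "stage n > 0" using le_stage_iff[of 1 n] by simp
    have "real (stage_start (stage n)) \<le> real n" using stage_start_stage_le[of n] by linarith
    then have "real (stage n) * 2 ^ stage n \<le> real n" by (simp add: stage_start_def)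
    moreover from this \<open>stage n > 0\<close> have "real n > 0"
      by (metis mult_pos_pos of_nat_0_less_iff order.strict_trans2 zero_less_numeral zero_less_power)
    ultimately show ?case using \<open>stage n > 0\<close> by (simp add: field_simps)
  qed
  show "(\<lambda>n. 1 / real (stage n)) \<longlonglongrightarrow> 0"
    by (rule filterlim_compose[OF _ filterlim_stage]) real_asymp
qed

lemma normal_seq_iff_match_count:
  "normal_seq x \<longleftrightarrow> (\<forall>v. v \<noteq> [] \<longrightarrow>
    (\<lambda>n. real (match_count x v n) / real n) \<longlonglongrightarrow> 1 / 2 ^ length v)"
  unfolding normal_seq_def occurrences_ratio_iff by (auto simp: Suc_le_eq)

lemma normal_seq_base: "normal_seq base"
  unfolding normal_seq_iff_match_count
proof (intro allI impI)
  fix v :: "bool list"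
  let ?c = "2 * (real (length v) + 5)"
  have "(\<lambda>n. real (match_count base v n) / real n - 1 / 2 ^ length v) \<longlonglongrightarrow> 0"
  proof (rule Lim_null_comparison)
    show "\<forall>\<^sub>F n in sequentially. norm (real (match_count base v n) / real n - 1 / 2 ^ length v) \<le>
        ?c * (2 ^ stage n / real n)"
      using eventually_gt_at_top[of 0]
    proof eventually_elim
      case (elim n)
      obtain s j where n: "n = stage_start s + j" "j < (s + 2) * 2 ^ s" "stage n = s" by (rule stageE)
      have "\<bar>\<Sum>i<n. discrepancy base v i\<bar> \<le> ?c * 2 ^ stage n"
        using base_discrepancy[of j s v] n by simp
      then have "\<bar>real (match_count base v n) - real n / 2 ^ length v\<bar> \<le> ?c * 2 ^ stage n"
        by (simp add: discrepancy_def sum_subtractf sum_matches)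
      then have "\<bar>real (match_count base v n) - real n / 2 ^ length v\<bar> / real n \<le> ?c * 2 ^ stage n / real n"
        by (rule divide_right_mono) simp
      moreover have "real (match_count base v n) / real n - 1 / 2 ^ length v =
          (real (match_count base v n) - real n / 2 ^ length v) / real n"
        using elim by (simp add: diff_divide_distrib)
      ultimately show ?case by (simp add: abs_divide)
    qed
    show "(\<lambda>n. ?c * (2 ^ stage n / real n)) \<longlonglongrightarrow> 0"
      using tendsto_mult_left[OF power_stage_over_index, of ?c] by simp
  qed
  then show "(\<lambda>n. real (match_count base v n) / real n) \<longlonglongrightarrow> 1 / 2 ^ length v"
    by (simp add: LIM_zero_iff)
qed

section \<open>Normality under changes of density zero\<close>

definition differences :: "(nat \<Rightarrow> bool) \<Rightarrow> (nat \<Rightarrow> bool) \<Rightarrow> nat \<Rightarrow> nat" where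
  "differences x y n = card {i. i < n \<and> x i \<noteq> y i}"

lemma differences_commute: "differences x y = differences y x"
  unfolding differences_def
  by (intro ext arg_cong[of _ _ card]) auto

lemma differences_add_le: "differences x y (n + k) \<le> differences x y n + k"
proof -
  have "differences x y (n + k) \<le> card ({i. i < n \<and> x i \<noteq> y i} \<union> {n..<n + k})"
    unfolding differences_def by (rule card_mono) auto
  also have "\<dots> \<le> differences x y n + k"
    unfolding differences_def using card_Un_le[of _ "{n..<n + k}"] by simp
  finally show ?thesis .
qed

text \<open>An occurrence in \<open>x\<close> that is lost in \<open>y\<close> covers a difference,
  and each difference is covered by at most \<open>length v\<close> starting positions. The inner
  summand \<open>length v\<close> pays for differences beyond position \<open>n\<close>.\<close>

lemma match_count_le_differences:
  "match_count x v n \<le> match_count y v n + length v * (differences x y n + length v)"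
proof -
  let ?D = "{i. i < n + length v \<and> x i \<noteq> y i}"
  have "{i. i < n \<and> matches x v i} \<subseteq>
    {i. i < n \<and> matches y v i} \<union> (\<Union>j<length v. (\<lambda>i. i - j) ` ?D)"
  proof
    fix i assume i: "i \<in> {i. i < n \<and> matches x v i}"
    show "i \<in> {i. i < n \<and> matches y v i} \<union> (\<Union>j<length v. (\<lambda>i. i - j) ` ?D)"
    proof (cases "matches y v i")
      case False
      with i obtain j where "j < length v" "x (i + j) \<noteq> y (i + j)" unfolding matches_def by auto
      with i have "j < length v" "i \<in> (\<lambda>i. i - j) ` ?D"
        by (auto intro!: image_eqI[of _ _ "i + j"])
      then show ?thesis by blast
    qed (use i in simp)
  qed
  then have "match_count x v n \<le> card ({i. i < n \<and> matches y v i} \<union> (\<Union>j<length v. (\<lambda>i. i - j) ` ?D))"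
    unfolding match_count_def by (intro card_mono) auto
  also have "\<dots> \<le> match_count y v n + card (\<Union>j<length v. (\<lambda>i. i - j) ` ?D)"
    unfolding match_count_def by (rule card_Un_le)
  also have "card (\<Union>j<length v. (\<lambda>i. i - j) ` ?D) \<le> (\<Sum>j<length v. card ((\<lambda>i. i - j) ` ?D))"
    by (rule card_UN_le) simp
  also have "\<dots> \<le> (\<Sum>j<length v. differences x y n + length v)"
    using differences_add_le[of x y n "length v"]
    by (intro sum_mono order.trans[OF card_image_le]) (auto simp: differences_def)
  finally show ?thesis by simp
qed

lemma normal_seq_density_zero_change:
  assumes "normal_seq x" and dens: "(\<lambda>n. real (differences x y n) / real n) \<longlonglongrightarrow> 0"
  shows "normal_seq y"
  unfolding normal_seq_iff_match_count
proof (intro allI impI)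
  fix v :: "bool list" assume "v \<noteq> []"
  let ?m = "length v"
  have "(\<lambda>n. real (match_count y v n) / real n - real (match_count x v n) / real n) \<longlonglongrightarrow> 0"
  proof (rule Lim_null_comparison)
    have "\<bar>real (match_count y v n) - real (match_count x v n)\<bar> \<le>
        real ?m * (real (differences x y n) + real ?m)" for n
    proof -
      have "real (match_count y v n) \<le> real (match_count x v n + ?m * (differences x y n + ?m))"
        using match_count_le_differences[of y v n x] by (simp only: of_nat_le_iff differences_commute)
      moreover have "real (match_count x v n) \<le> real (match_count y v n + ?m * (differences x y n + ?m))"
        using match_count_le_differences[of x v n y] by (simp only: of_nat_le_iff)
      ultimately show ?thesis by (simp add: abs_le_iff)
    qed
    then have "\<bar>real (match_count y v n) - real (match_count x v n)\<bar> / real n \<le>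
        real ?m * (real (differences x y n) + real ?m) / real n" for n
      by (rule divide_right_mono) simp
    then show "\<forall>\<^sub>F n in sequentially. norm (real (match_count y v n) / real n -
        real (match_count x v n) / real n) \<le>
        real ?m * (real (differences x y n) / real n + real ?m / real n)"
      by (simp add: diff_divide_distrib[symmetric] add_divide_distrib[symmetric] abs_divide)
    have "(\<lambda>n. real ?m / real n) \<longlonglongrightarrow> 0" by real_asymp
    then show "(\<lambda>n. real ?m * (real (differences x y n) / real n + real ?m / real n)) \<longlonglongrightarrow> 0"
      using tendsto_mult_left[OF tendsto_add[OF dens], of _ 0 "real ?m"] by simp
  qed
  then have "(\<lambda>n. (real (match_count y v n) / real n - real (match_count x v n) / real n) +
      real (match_count x v n) / real n) \<longlonglongrightarrow> 0 + 1 / 2 ^ ?m"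
    by (rule tendsto_add) (use assms(1) \<open>v \<noteq> []\<close> in \<open>simp add: normal_seq_iff_match_count\<close>)
  then show "(\<lambda>n. real (match_count y v n) / real n) \<longlonglongrightarrow> 1 / 2 ^ ?m"
    by simp
qed

subsection \<open>Perturbation of the stages\<close>

text \<open>Length of the planted run. It is at least the word length \<open>s\<close>, so it
  dominates its stage, with a relative excess of about \<open>1 / (p s + 1)\<close>.\<close>

definition peak :: "(nat \<Rightarrow> nat) \<Rightarrow> nat \<Rightarrow> nat" where
  "peak p s = s + s div (p s + 1)"

text \<open>Length of the overwritten part, in whole blocks. Two blocks are always granted to make
  room for the planted run. For small \<open>s\<close> the value can exceed the stage length, but
  \<open>perturbed\<close> applies it only within the stage.\<close>

definition gap :: "(nat \<Rightarrow> nat) \<Rightarrow> nat \<Rightarrow> nat" where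
  "gap q s = (s + 2) * (2 + 2 ^ s div (q s + 2))"

text \<open>Position 0 of every stage is a zero, which stops runs of ones at stage boundaries. A
  digit depends on \<open>p\<close> and \<open>q\<close> only at its own stage, as the later fixed
  point requires.\<close>

definition perturbed :: "(nat \<Rightarrow> nat) \<Rightarrow> (nat \<Rightarrow> nat) \<Rightarrow> nat \<Rightarrow> bool" where
  "perturbed p q i = (let s = stage i; j = i - stage_start s
    in if j < gap q s then 1 \<le> j \<and> j \<le> peak p s else base i)"

lemma perturbed_stage:
  "j < (s + 2) * 2 ^ s \<Longrightarrow> perturbed p q (stage_start s + j) =
    (if j < gap q s then 1 \<le> j \<and> j \<le> peak p s else base (stage_start s + j))"
  by (simp add: perturbed_def Let_def)

lemma peak_le: "peak p s \<le> 2 * s"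
  unfolding peak_def using div_le_dividend[of s "p s + 1"] by linarith

lemma peak_less_gap: "peak p s + 1 < gap q s"
proof -
  have "(s + 2) * 2 \<le> gap q s" unfolding gap_def by (rule mult_le_mono2) simp
  then show ?thesis using peak_le[of p s] by simp
qed

lemma peak_less_stage_length: "peak p s + 1 < (s + 2) * 2 ^ s"
proof (cases s)
  case 0
  then show ?thesis by (simp add: peak_def)
next
  case (Suc t)
  then have "(s + 2) * 2 ^ 1 \<le> (s + 2) * 2 ^ s" by (intro mult_le_mono2 power_increasing) auto
  then show ?thesis using peak_le[of p s] by simp
qed

lemma not_perturbed_stage_start: "\<not> perturbed p q (stage_start s)"
  using perturbed_stage[of 0 s p q] peak_less_gap[of p s q] by simp

lemma perturbed_after_stage_start: "s > 0 \<Longrightarrow> perturbed p q (stage_start s + 1)"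
  using perturbed_stage[of 1 s p q] peak_less_gap[of p s q] peak_less_stage_length[of p s]
  by (simp add: peak_def)

section \<open>Runs of ones and typicality\<close>

lemma base_separator:
  assumes "j < (s + 2) * 2 ^ s" "s \<le> j mod (s + 2)"
  shows "\<not> base (stage_start s + j)"
  using assms by (simp add: base_def Let_def)

text \<open>A run beginning no later than the planted one ends is confined by the zeros around the
  latter. A run beginning later meets a zero within \<open>s\<close> steps: in the gap, between
  words, or at the next stage start.\<close>

lemma perturbed_run_le:
  assumes run: "\<And>i. i \<in> {k..<k + l} \<Longrightarrow> perturbed p q i"
  shows "l \<le> peak p (stage k)"
proof (rule ccontr)
  assume "\<not> l \<le> peak p (stage k)"
  obtain s j where k: "k = stage_start s + j" "j < (s + 2) * 2 ^ s" "stage k = s" by (rule stageE)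
  have l: "l > peak p s" using \<open>\<not> l \<le> peak p (stage k)\<close> k by simp
  have one: "perturbed p q (stage_start s + j')" if "j \<le> j'" "j' < j + l" for j'
    using run[of "stage_start s + j'"] that k by simp
  show False
  proof (cases "j \<le> peak p s")
    case True
    have "\<not> perturbed p q (stage_start s + (peak p s + 1))"
      using perturbed_stage[OF peak_less_stage_length] peak_less_gap by simp
    then have "j = 0" using one[of "peak p s + 1"] True l by linarith
    then show False using one[of 0] l not_perturbed_stage_start by auto
  next
    case False
    \<comment> \<open>The first separator position at or after \<open>j\<close>. If \<open>j\<close>
      is already the second zero of its block, truncated subtraction gives
      \<open>j' = j\<close>.\<close>
    define j' where "j' = j + (s - j mod (s + 2))"
    have j': "j \<le> j'" "j' < j + l" using l by (auto simp: j'_def peak_def)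
    have sep: "s \<le> j' mod (s + 2)"
    proof (cases "j mod (s + 2) \<le> s")
      case True
      have "j' = j div (s + 2) * (s + 2) + s"
        using True div_mult_mod_eq[of j "s + 2"] unfolding j'_def by linarith
      then have "j' mod (s + 2) = s mod (s + 2)" by (simp only: mod_mult_self3)
      then show ?thesis by simp
    next
      case False
      then show ?thesis by (simp add: j'_def)
    qed
    show False
    proof (cases "j' < (s + 2) * 2 ^ s")
      case True
      \<comment> \<open>Inside the gap the digit is zero because \<open>j'\<close> lies beyond the
        planted run, outside it because of the separator.\<close>
      have "\<not> perturbed p q (stage_start s + j')"
        unfolding perturbed_stage[OF True] using base_separator[OF True sep] False j' by auto
      then show False using one j' by blast
    next
      case False
      then have "perturbed p q (stage_start s + (s + 2) * 2 ^ s)"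
        using k(2) j' by (intro one) linarith+
      then show False using not_perturbed_stage_start by (metis stage_start_Suc)
    qed
  qed
qed

lemma finite_run_lengths: "finite {l. \<exists>k. k + l \<le> (n::nat) \<and> (\<forall>i\<in>{k..<k + l}. x i)}"
proof (rule finite_subset)
  show "{l. \<exists>k. k + l \<le> n \<and> (\<forall>i\<in>{k..<k + l}. x i)} \<subseteq> {..n}"
    by auto
qed simp

lemma longest_run_ge: "k + l \<le> n \<Longrightarrow> \<forall>i\<in>{k..<k + l}. x i \<Longrightarrow> l \<le> longest_run x n"
  unfolding longest_run_def by (rule Max_ge[OF finite_run_lengths]) blast

lemma longest_run_le:
  assumes "\<And>k l. k + l \<le> n \<Longrightarrow> \<forall>i\<in>{k..<k + l}. x i \<Longrightarrow> l \<le> b"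
  shows "longest_run x n \<le> b"
  unfolding longest_run_def
proof (rule Max.boundedI[OF finite_run_lengths])
  have "0 \<in> {l. \<exists>k. k + l \<le> n \<and> (\<forall>i\<in>{k..<k + l}. x i)}" by auto
  then show "{l. \<exists>k. k + l \<le> n \<and> (\<forall>i\<in>{k..<k + l}. x i)} \<noteq> {}" by blast
qed (use assms in blast)

lemma longest_run_perturbed_ge:
  assumes "stage_start (Suc s) \<le> n" shows "peak p s \<le> longest_run (perturbed p q) n"
proof (rule longest_run_ge[of "stage_start s + 1"])
  show "stage_start s + 1 + peak p s \<le> n"
    using assms peak_less_stage_length[of p s] by (simp add: stage_start_Suc)
  show "\<forall>i\<in>{stage_start s + 1..<stage_start s + 1 + peak p s}. perturbed p q i"
  proof
    fix i assume "i \<in> {stage_start s + 1..<stage_start s + 1 + peak p s}"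
    then obtain j where j: "i = stage_start s + j" "1 \<le> j" "j \<le> peak p s"
      by (auto dest: le_Suc_ex)
    then have "j < (s + 2) * 2 ^ s" using peak_less_stage_length[of p s] by linarith
    then show "perturbed p q i"
      using j peak_less_gap[of p s q] by (simp add: perturbed_stage)
  qed
qed

lemma longest_run_perturbed_le:
  assumes "n \<le> stage_start (Suc s)" "\<And>t. t \<le> s \<Longrightarrow> peak p t \<le> b"
  shows "longest_run (perturbed p q) n \<le> b"
proof (rule longest_run_le)
  fix k l assume kl: "k + l \<le> n" "\<forall>i\<in>{k..<k + l}. perturbed p q i"
  show "l \<le> b"
  proof (cases "l = 0")
    case False
    then have "k < stage_start (Suc s)" using kl assms(1) by linarith
    then have "stage k \<le> s" using le_stage_iff[of "Suc s" k] by linarith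
    then show ?thesis using perturbed_run_le[of k l p q] kl(2) assms(2) by fastforce
  qed simp
qed

lemma log_stage_start: "s > 0 \<Longrightarrow> log 2 (stage_start s) = s + log 2 s"
  by (simp add: stage_start_def log_mult log_nat_power)

text \<open>Lets typicality compare runs with the stage number: \<open>n\<close> lies between two
  consecutive stage starts, whose logarithms equal their stage numbers up to a logarithmic
  term.\<close>

lemma log_index_bounds:
  assumes "stage n > 0"
  shows "stage n \<le> log 2 n" "log 2 n \<le> Suc (stage n) + log 2 (Suc (stage n))"
proof -
  have n: "real (stage_start (stage n)) \<le> n" "real n \<le> stage_start (Suc (stage n))"
    using stage_start_stage_le[of n] less_stage_start_Suc_stage[of n] by (auto intro: less_imp_le)
  have pos: "0 < real (stage_start (stage n))" using assms by (simp add: stage_start_def)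
  have "stage n \<le> log 2 (stage_start (stage n))" using assms by (simp add: log_stage_start)
  also have "\<dots> \<le> log 2 n" using n pos by simp
  finally show "stage n \<le> log 2 n" .
  have "log 2 n \<le> log 2 (stage_start (Suc (stage n)))" using n pos by simp
  then show "log 2 n \<le> Suc (stage n) + log 2 (Suc (stage n))"
    by (simp only: log_stage_start[OF zero_less_Suc])
qed

lemma eventually_stage: "(\<forall>\<^sub>F s in sequentially. Q s) \<Longrightarrow> \<forall>\<^sub>F n in sequentially. Q (stage n)"
  using filterlim_stage by (simp add: filterlim_iff)

text \<open>The longest run may come from any earlier stage, so all peaks up to \<open>s\<close> are
  bounded at once. The stages before \<open>S\<close>, where \<open>p\<close> may be small, have
  peaks below \<open>2 * S\<close>, which is harmless once \<open>s \<ge> 2 * S\<close>.\<close>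

lemma eventually_peaks_le:
  fixes e :: real
  assumes p: "filterlim p at_top sequentially" and "e > 0"
  shows "\<forall>\<^sub>F s in sequentially. \<forall>t\<le>s. real (peak p t) \<le> (1 + e) * s"
proof -
  obtain K :: nat where K: "1 / e \<le> K" using real_arch_simple by blast
  obtain S where S: "\<And>s. s \<ge> S \<Longrightarrow> p s \<ge> K"
    using p unfolding filterlim_at_top eventually_sequentially by blast
  show ?thesis
    using eventually_ge_at_top[of "2 * S"]
  proof eventually_elim
    case (elim s)
    show ?case
    proof (intro allI impI)
      fix t assume "t \<le> s"
      show "real (peak p t) \<le> (1 + e) * s"
      proof (cases "t < S")
        case True
        then have "real (peak p t) \<le> s" using peak_le[of p t] elim by linarith
        also have "\<dots> \<le> (1 + e) * s" using \<open>e > 0\<close> by (simp add: algebra_simps)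
        finally show ?thesis .
      next
        case False
        then have "1 / e \<le> real (p t + 1)" using S[of t] K by simp
        then have "1 \<le> e * real (p t + 1)" using \<open>e > 0\<close> by (simp add: field_simps)
        then have "t \<le> e * real (p t + 1) * t" using mult_right_mono[of 1 _ "real t"] by simp
        then have "t / real (p t + 1) \<le> e * t" by (simp add: field_simps)
        moreover have "real (t div (p t + 1)) \<le> t / real (p t + 1)" by (rule of_nat_div_le_of_nat)
        ultimately have "real (peak p t) \<le> (1 + e) * t" by (simp add: peak_def algebra_simps)
        also have "\<dots> \<le> (1 + e) * s" using \<open>t \<le> s\<close> \<open>e > 0\<close> by (intro mult_left_mono) auto
        finally show ?thesis .
      qed
    qed
  qed
qed

lemma typical_seq_perturbed:
  assumes "filterlim p at_top sequentially"
  shows "typical_seq (perturbed p q)"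
  unfolding typical_seq_def
proof (rule order_tendstoI)
  let ?L = "\<lambda>n. real (longest_run (perturbed p q) n) / log 2 (real n)"
  fix a :: real assume "a < 1"
  have "(\<lambda>s. (real s - 1) / (real (Suc s) + log 2 (real (Suc s)))) \<longlonglongrightarrow> 1"
    by real_asymp
  then have "\<forall>\<^sub>F s in sequentially. a < (real s - 1) / (real (Suc s) + log 2 (real (Suc s)))"
    using \<open>a < 1\<close> by (rule order_tendstoD)
  from eventually_stage[OF this] eventually_stage[OF eventually_gt_at_top[of 0]]
  show "\<forall>\<^sub>F n in sequentially. a < ?L n"
  proof eventually_elim
    case (elim n)
    \<comment> \<open>Only the preceding stage is sure to be complete before \<open>n\<close>; this
      costs the summand 1.\<close>
    have "peak p (stage n - 1) \<le> longest_run (perturbed p q) n"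
      using elim(2) stage_start_stage_le[of n] by (intro longest_run_perturbed_ge) simp
    then have L: "real (stage n) - 1 \<le> real (longest_run (perturbed p q) n)"
      unfolding peak_def by linarith
    note b = log_index_bounds[OF elim(2)]
    have "(real (stage n) - 1) / (real (Suc (stage n)) + log 2 (real (Suc (stage n)))) \<le> ?L n"
      using L b elim(2) by (intro frac_le) auto
    with elim(1) show ?case by (rule less_le_trans)
  qed
next
  let ?L = "\<lambda>n. real (longest_run (perturbed p q) n) / log 2 (real n)"
  fix a :: real assume "1 < a"
  define e where "e = (a - 1) / 2"
  have e: "e > 0" "1 + e < a" using \<open>1 < a\<close> by (auto simp: e_def field_simps)
  from eventually_stage[OF eventually_peaks_le[OF assms \<open>e > 0\<close>]]
    eventually_stage[OF eventually_gt_at_top[of 0]]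
  show "\<forall>\<^sub>F n in sequentially. ?L n < a"
  proof eventually_elim
    case (elim n)
    have "longest_run (perturbed p q) n \<le> nat \<lfloor>(1 + e) * stage n\<rfloor>"
      using elim(1) less_stage_start_Suc_stage[of n]
      by (intro longest_run_perturbed_le[of n "stage n"]) (auto simp: le_nat_floor)
    then have "real (longest_run (perturbed p q) n) \<le> (1 + e) * stage n"
      using e by (simp add: le_nat_iff le_floor_iff)
    also have "\<dots> \<le> (1 + e) * log 2 n"
      using e log_index_bounds(1)[OF elim(2)] by (intro mult_left_mono) auto
    finally have "?L n \<le> 1 + e"
      using log_index_bounds(1)[OF elim(2)] elim(2) by (simp add: divide_simps)
    with e(2) show ?case by simp
  qed
qed

lemma real_div_nat_ge: "real n / real d - 1 \<le> real (n div d)"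
proof -
  have "real n / real d < of_int \<lfloor>real n / real d\<rfloor> + 1" by linarith
  then show ?thesis by (simp add: floor_divide_of_nat_eq)
qed

lemma not_filterlim_at_top_frequently:
  fixes p :: "nat \<Rightarrow> nat"
  assumes "\<not> filterlim p at_top sequentially"
  obtains K where "\<exists>\<^sub>F s in sequentially. p s \<le> K"
proof -
  obtain K where "\<not> (\<forall>\<^sub>F s in sequentially. K \<le> p s)"
    using assms unfolding filterlim_at_top by blast
  then have "\<exists>\<^sub>F s in sequentially. p s \<le> K"
    unfolding frequently_def by (rule contrapos_nn) (auto elim: eventually_mono)
  then show thesis by (rule that)
qed

text \<open>Whenever \<open>p s \<le> K\<close>, the planted run has length at least
  \<open>(1 + c) * s - 1\<close> with \<open>c = 1 / (K + 1)\<close>. At the ends of these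
  infinitely many stages the ratio stays above \<open>1 + c / 2\<close>.\<close>

lemma not_typical_seq_perturbed:
  assumes "\<not> filterlim p at_top sequentially"
  shows "\<not> typical_seq (perturbed p q)"
proof
  assume "typical_seq (perturbed p q)"
  obtain K where K: "\<exists>\<^sub>F s in sequentially. p s \<le> K"
    by (rule not_filterlim_at_top_frequently[OF assms])
  define c where "c = 1 / real (K + 1)"
  have c: "c > 0" by (simp add: c_def)
  let ?R = "\<lambda>s. real (longest_run (perturbed p q) (stage_start (Suc s))) / log 2 (stage_start (Suc s))"
  let ?h = "\<lambda>s. ((1 + c) * real s - 1) / (real (Suc s) + log 2 (real (Suc s)))"
  have "(\<lambda>n. real (longest_run (perturbed p q) n) / log 2 n) \<longlonglongrightarrow> 1"
    using \<open>typical_seq (perturbed p q)\<close> by (simp add: typical_seq_def)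
  moreover have "filterlim (\<lambda>s. stage_start (Suc s)) at_top sequentially"
    using filterlim_compose[OF filterlim_stage_start filterlim_Suc] .
  ultimately have "?R \<longlonglongrightarrow> 1" by (rule filterlim_compose)
  moreover have "1 < 1 + c / 2" using c by simp
  ultimately have "\<forall>\<^sub>F s in sequentially. ?R s < 1 + c / 2" by (rule order_tendstoD)
  moreover have "?h \<longlonglongrightarrow> 1 + c" by real_asymp
  then have "\<forall>\<^sub>F s in sequentially. 1 + c / 2 < ?h s"
    by (rule order_tendstoD) (use c in simp)
  ultimately have "\<forall>\<^sub>F s in sequentially. \<not> p s \<le> K"
  proof eventually_elim
    case (elim s)
    show ?case
    proof
      assume "p s \<le> K"
      then have "s div (K + 1) \<le> s div (p s + 1)" by (intro div_le_mono2) auto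
      moreover have "c * s - 1 \<le> real (s div (K + 1))"
        using real_div_nat_ge[of s "K + 1"] by (simp add: c_def)
      ultimately have "(1 + c) * s - 1 \<le> real (peak p s)"
        by (simp add: peak_def algebra_simps)
      also have "\<dots> \<le> longest_run (perturbed p q) (stage_start (Suc s))"
        using longest_run_perturbed_ge[of s "stage_start (Suc s)" p q] by simp
      finally have "?h s \<le> ?R s"
        unfolding log_stage_start[OF zero_less_Suc] by (intro divide_right_mono) auto
      with elim show False by simp
    qed
  qed
  with K show False by (simp add: frequently_def)
qed

lemma typical_seq_perturbed_iff:
  "typical_seq (perturbed p q) \<longleftrightarrow> filterlim p at_top sequentially"
  using typical_seq_perturbed not_typical_seq_perturbed by blast

section \<open>Normality of the perturbed sequence\<close>

lemma sum_over_power_tendsto_0: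
  fixes d :: "nat \<Rightarrow> real"
  assumes "(\<lambda>s. d s / 2 ^ s) \<longlonglongrightarrow> 0"
  shows "(\<lambda>s. (\<Sum>t\<le>s. d t) / 2 ^ s) \<longlonglongrightarrow> 0"
proof (rule LIMSEQ_I)
  fix e :: real assume "e > 0"
  obtain S where S: "\<And>s. s \<ge> S \<Longrightarrow> \<bar>d s / 2 ^ s\<bar> < e / 4"
    using LIMSEQ_D[OF assms, of "e / 4"] \<open>e > 0\<close> by auto
  define c where "c = \<bar>\<Sum>t\<le>S. d t\<bar>"
  \<comment> \<open>The constant \<open>e / 4\<close> makes the bound reproduce itself: the new term
    adds at most \<open>e / 4 * 2 ^ (S + Suc k)\<close>, as much as the old multiple of
    \<open>e / 2\<close>, and the power doubles.\<close>
  have bound: "\<bar>\<Sum>t\<le>S + k. d t\<bar> \<le> c + e / 2 * 2 ^ (S + k)" for k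
  proof (induction k)
    case 0
    then show ?case using \<open>e > 0\<close> by (simp add: c_def)
  next
    case (Suc k)
    have "\<bar>d (S + Suc k)\<bar> \<le> e / 4 * 2 ^ (S + Suc k)"
      using S[of "S + Suc k"] by (simp add: abs_divide field_simps)
    then show ?case using Suc by (simp add: abs_le_iff) linarith
  qed
  have "(\<lambda>s. c / 2 ^ s) \<longlonglongrightarrow> 0" by real_asymp
  then obtain S' where S': "\<And>s. s \<ge> S' \<Longrightarrow> c / 2 ^ s < e / 2"
    using order_tendstoD(2)[of _ 0 sequentially "e / 2"] \<open>e > 0\<close>
    unfolding eventually_sequentially by (meson half_gt_zero)
  show "\<exists>no. \<forall>s\<ge>no. norm ((\<Sum>t\<le>s. d t) / 2 ^ s - 0) < e"
  proof (intro exI allI impI)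
    fix s assume s: "s \<ge> max S S'"
    then have "\<bar>\<Sum>t\<le>s. d t\<bar> \<le> c + e / 2 * 2 ^ s" using bound[of "s - S"] by simp
    then have "\<bar>\<Sum>t\<le>s. d t\<bar> / 2 ^ s \<le> (c + e / 2 * 2 ^ s) / 2 ^ s"
      by (rule divide_right_mono) simp
    also have "\<dots> = c / 2 ^ s + e / 2" by (simp add: add_divide_distrib)
    also have "\<dots> < e / 2 + e / 2" by (rule add_strict_right_mono, rule S') (use s in simp)
    also have "\<dots> = e" by simp
    finally show "norm ((\<Sum>t\<le>s. d t) / 2 ^ s - 0) < e" by (simp add: abs_divide)
  qed
qed

text \<open>Differences lie in the gaps. Replacing the factors \<open>t + 2\<close> by
  \<open>s + 2\<close> leaves a sum to which \<open>sum_over_power_tendsto_0\<close>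
  applies.\<close>

lemma differences_base_perturbed_le:
  assumes "n \<le> stage_start (Suc s)"
  shows "differences base (perturbed p q) n \<le> (s + 2) * (\<Sum>t\<le>s. 2 + 2 ^ t div (q t + 2))"
proof -
  have "{i. i < n \<and> base i \<noteq> perturbed p q i} \<subseteq> (\<Union>t\<le>s. (\<lambda>j. stage_start t + j) ` {..<gap q t})"
  proof
    fix i assume i: "i \<in> {i. i < n \<and> base i \<noteq> perturbed p q i}"
    obtain t j where t: "i = stage_start t + j" "j < (t + 2) * 2 ^ t" "stage i = t" by (rule stageE)
    have "i < stage_start (Suc s)" using i assms by simp
    then have "t \<le> s" using le_stage_iff[of "Suc s" i] t by linarith
    moreover have "j < gap q t"
      using i t perturbed_stage[OF t(2), of p q] by (auto split: if_splits)
    ultimately show "i \<in> (\<Union>t\<le>s. (\<lambda>j. stage_start t + j) ` {..<gap q t})" using t(1) by blast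
  qed
  then have "differences base (perturbed p q) n \<le> card (\<Union>t\<le>s. (\<lambda>j. stage_start t + j) ` {..<gap q t})"
    unfolding differences_def by (intro card_mono) auto
  also have "\<dots> \<le> (\<Sum>t\<le>s. card ((\<lambda>j. stage_start t + j) ` {..<gap q t}))"
    by (rule card_UN_le) simp
  also have "\<dots> \<le> (\<Sum>t\<le>s. (s + 2) * (2 + 2 ^ t div (q t + 2)))"
  proof (rule sum_mono)
    fix t assume "t \<in> {..s}"
    have "card ((\<lambda>j. stage_start t + j) ` {..<gap q t}) \<le> gap q t"
      using card_image_le[of "{..<gap q t}"] by simp
    also have "\<dots> \<le> (s + 2) * (2 + 2 ^ t div (q t + 2))"
      unfolding gap_def using \<open>t \<in> {..s}\<close> by (intro mult_le_mono1) simp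
    finally show "card ((\<lambda>j. stage_start t + j) ` {..<gap q t}) \<le> (s + 2) * (2 + 2 ^ t div (q t + 2))" .
  qed
  also have "\<dots> = (s + 2) * (\<Sum>t\<le>s. 2 + 2 ^ t div (q t + 2))" by (rule sum_distrib_left[symmetric])
  finally show ?thesis .
qed

text \<open>If \<open>q\<close> diverges, the gaps have density zero. The gap of the current stage
  is counted in full, and \<open>n\<close> is replaced by the smaller
  \<open>stage_start (stage n)\<close>, so the bound depends on the stage alone.\<close>

lemma normal_seq_perturbed:
  assumes "filterlim q at_top sequentially"
  shows "normal_seq (perturbed p q)"
proof (rule normal_seq_density_zero_change[OF normal_seq_base])
  define d where "d s = real (2 + 2 ^ s div (q s + 2))" for s
  have "(\<lambda>s. d s / 2 ^ s) \<longlonglongrightarrow> 0"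
  proof (rule Lim_null_comparison)
    have "d s / 2 ^ s \<le> 2 / 2 ^ s + 1 / real (q s)" if "q s > 0" for s
    proof -
      have "real (2 ^ s div (q s + 2)) \<le> 2 ^ s / real (q s + 2)"
        using of_nat_div_le_of_nat[of "2 ^ s" "q s + 2", where 'a = real] by simp
      also have "\<dots> \<le> 2 ^ s / real (q s)" using that by (intro divide_left_mono) auto
      finally have "d s \<le> 2 + 2 ^ s / real (q s)" by (simp add: d_def)
      then have "d s / 2 ^ s \<le> (2 + 2 ^ s / real (q s)) / 2 ^ s" by (rule divide_right_mono) simp
      then show ?thesis by (simp add: add_divide_distrib)
    qed
    moreover have "\<forall>\<^sub>F s in sequentially. q s \<ge> 1"
      using assms unfolding filterlim_at_top by blast
    ultimately show "\<forall>\<^sub>F s in sequentially. norm (d s / 2 ^ s) \<le> 2 / 2 ^ s + 1 / real (q s)"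
      by (auto simp: d_def elim: eventually_mono)
    have "(\<lambda>s. 1 / real (q s)) \<longlonglongrightarrow> 0"
      by (rule filterlim_compose[OF _ assms]) real_asymp
    moreover have "(\<lambda>s. 2 / 2 ^ s :: real) \<longlonglongrightarrow> 0" by real_asymp
    ultimately show "(\<lambda>s. 2 / 2 ^ s + 1 / real (q s)) \<longlonglongrightarrow> 0"
      by (intro tendsto_add_zero)
  qed
  then have "(\<lambda>s. (\<Sum>t\<le>s. d t) / 2 ^ s) \<longlonglongrightarrow> 0"
    by (rule sum_over_power_tendsto_0)
  moreover have "(\<lambda>s. real (s + 2) / real s) \<longlonglongrightarrow> 1" by real_asymp
  ultimately have "(\<lambda>s. real (s + 2) / real s * ((\<Sum>t\<le>s. d t) / 2 ^ s)) \<longlonglongrightarrow> 1 * 0"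
    by (intro tendsto_mult)
  then have lim: "(\<lambda>n. real (stage n + 2) / real (stage n) * ((\<Sum>t\<le>stage n. d t) / 2 ^ stage n)) \<longlonglongrightarrow> 0"
    using filterlim_compose[OF _ filterlim_stage] by simp
  show "(\<lambda>n. real (differences base (perturbed p q) n) / real n) \<longlonglongrightarrow> 0"
  proof (rule Lim_null_comparison[OF _ lim])
    show "\<forall>\<^sub>F n in sequentially. norm (real (differences base (perturbed p q) n) / real n) \<le>
      real (stage n + 2) / real (stage n) * ((\<Sum>t\<le>stage n. d t) / 2 ^ stage n)"
      using eventually_stage[OF eventually_gt_at_top[of 0]]
    proof eventually_elim
      case (elim n)
      have "differences base (perturbed p q) n \<le> (stage n + 2) * (\<Sum>t\<le>stage n. 2 + 2 ^ t div (q t + 2))"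
        using less_stage_start_Suc_stage[of n] by (intro differences_base_perturbed_le) simp
      then have "real (differences base (perturbed p q) n) \<le>
          real ((stage n + 2) * (\<Sum>t\<le>stage n. 2 + 2 ^ t div (q t + 2)))"
        by (rule of_nat_mono)
      also have "\<dots> = real (stage n + 2) * (\<Sum>t\<le>stage n. d t)"
        unfolding d_def by (simp only: of_nat_mult of_nat_sum)
      finally have D: "real (differences base (perturbed p q) n) \<le> real (stage n + 2) * (\<Sum>t\<le>stage n. d t)" .
      have pos: "0 < real (stage_start (stage n))" using elim by (simp add: stage_start_def)
      have "real (differences base (perturbed p q) n) / real n \<le>
          real (stage n + 2) * (\<Sum>t\<le>stage n. d t) / real (stage_start (stage n))"
        using D pos stage_start_stage_le[of n] by (intro frac_le) (auto intro!: mult_nonneg_nonneg sum_nonneg simp: d_def)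
      then show ?case by (simp add: stage_start_def)
    qed
  qed
qed

lemma match_count_ones_perturbed_gap:
  assumes "z \<le> gap q s" "z \<le> (s + 2) * 2 ^ s"
  shows "match_count (perturbed p q) [True] (stage_start s + z) \<le>
      match_count (perturbed p q) [True] (stage_start s) + 2 * s"
proof -
  let ?x = "perturbed p q"
  have M: "match_count ?x [True] n = card {i. i < n \<and> ?x i}" for n
    by (simp add: match_count_def matches_def)
  have "{i. i < stage_start s + z \<and> ?x i} \<subseteq>
      {i. i < stage_start s \<and> ?x i} \<union> (\<lambda>j. stage_start s + j) ` {1..peak p s}"
  proof
    fix i assume i: "i \<in> {i. i < stage_start s + z \<and> ?x i}"
    show "i \<in> {i. i < stage_start s \<and> ?x i} \<union> (\<lambda>j. stage_start s + j) ` {1..peak p s}"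
    proof (cases "i < stage_start s")
      case False
      then obtain j where j: "i = stage_start s + j" by (metis le_Suc_ex not_less)
      then have "j \<in> {1..peak p s}"
        using i assms perturbed_stage[of j s p q] by (simp split: if_splits)
      then show ?thesis using j by blast
    qed (use i in simp)
  qed
  then have "match_count ?x [True] (stage_start s + z) \<le>
      card ({i. i < stage_start s \<and> ?x i} \<union> (\<lambda>j. stage_start s + j) ` {1..peak p s})"
    unfolding M by (intro card_mono) auto
  also have "\<dots> \<le> match_count ?x [True] (stage_start s) + card ((\<lambda>j. stage_start s + j) ` {1..peak p s})"
    unfolding M by (rule card_Un_le)
  also have "card ((\<lambda>j. stage_start s + j) ` {1..peak p s}) \<le> peak p s"
    using card_image_le[of "{1..peak p s}"] by simp
  also have "\<dots> \<le> 2 * s" by (rule peak_le)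
  finally show "match_count ?x [True] (stage_start s + z) \<le> match_count ?x [True] (stage_start s) + 2 * s"
    by simp
qed

text \<open>If \<open>q s \<le> K\<close>, a stretch of relative length about \<open>c\<close> after
  \<open>stage_start s\<close> holds at most \<open>2 * s\<close> ones. The frequency of ones then
  falls from about \<open>1 / 2\<close> to about \<open>1 / (2 * (1 + c))\<close>, so it cannot
  converge to \<open>1 / 2\<close>.\<close>

lemma not_normal_seq_perturbed:
  assumes "\<not> filterlim q at_top sequentially"
  shows "\<not> normal_seq (perturbed p q)"
proof
  assume normal: "normal_seq (perturbed p q)"
  obtain K where K: "\<exists>\<^sub>F s in sequentially. q s \<le> K"
    by (rule not_filterlim_at_top_frequently[OF assms])
  define c where "c = 1 / real (K + 2)"
  have c: "c > 0" by (simp add: c_def)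
  let ?ones = "match_count (perturbed p q) [True]"
  \<comment> \<open>A part of the gap whenever \<open>q s \<le> K\<close>; unlike
    \<open>gap q s\<close> it is independent of \<open>q\<close> and never leaves the stage.\<close>
  define z where "z s = (s + 2) * (2 ^ s div (K + 2))" for s :: nat
  let ?N = "\<lambda>s. stage_start s + z s"
  have half: "(\<lambda>n. real (?ones n) / real n) \<longlonglongrightarrow> 1 / 2"
    using normal[unfolded normal_seq_iff_match_count, rule_format, of "[True]"] by simp
  have start: "(\<lambda>s. real (?ones (stage_start s)) / real (stage_start s)) \<longlonglongrightarrow> 1 / 2"
    by (rule filterlim_compose[OF half filterlim_stage_start])
  have "filterlim ?N at_top sequentially"
    by (rule filterlim_at_top_mono[OF filterlim_stage_start]) simp
  then have after: "(\<lambda>s. real (?ones (?N s)) / real (?N s)) \<longlonglongrightarrow> 1 / 2"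
    by (rule filterlim_compose[OF half])
  \<comment> \<open>Bounds the frequency of ones at \<open>?N s\<close> when
    \<open>q s \<le> K\<close>: the first factor is the frequency at the stage start with the
    planted run added, the second rescales to a lower bound of \<open>?N s\<close>.\<close>
  let ?b = "\<lambda>s. (real (?ones (stage_start s)) / real (stage_start s) + 2 * real s / (real s * 2 ^ s)) *
    (real s * 2 ^ s / (real s * 2 ^ s + (real s + 2) * (2 ^ s * c - 1)))"
  have "(\<lambda>s. 2 * real s / (real s * 2 ^ s)) \<longlonglongrightarrow> 0" by real_asymp
  moreover have "(\<lambda>s. real s * 2 ^ s / (real s * 2 ^ s + (real s + 2) * (2 ^ s * c - 1))) \<longlonglongrightarrow> inverse (1 + c)"
    using c by real_asymp
  ultimately have "?b \<longlonglongrightarrow> (1 / 2 + 0) * (1 / (1 + c))"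
    unfolding inverse_eq_divide by (intro tendsto_mult tendsto_add start)
  moreover have "(1 / 2 + 0) * (1 / (1 + c)) < 1 / 2" using c by simp
  then obtain m where m: "(1 / 2 + 0) * (1 / (1 + c)) < m" "m < 1 / 2"
    using dense by blast
  ultimately have "\<forall>\<^sub>F s in sequentially. ?b s < m"
    using m(1) by (intro order_tendstoD(2))
  moreover have "\<forall>\<^sub>F s in sequentially. m < real (?ones (?N s)) / real (?N s)"
    using after m(2) by (rule order_tendstoD)
  moreover have "\<forall>\<^sub>F s::nat in sequentially. 0 < 2 ^ s * c - 1"
    using c by real_asymp
  ultimately have "\<forall>\<^sub>F s in sequentially. \<not> q s \<le> K"
    using eventually_gt_at_top[of 0]
  proof eventually_elim
    case (elim s)
    show ?case
    proof
      assume "q s \<le> K"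
      then have "2 ^ s div (K + 2) \<le> 2 ^ s div (q s + 2)" by (intro div_le_mono2) auto
      then have "z s \<le> gap q s" unfolding z_def gap_def by (intro mult_le_mono2) simp
      moreover have "z s \<le> (s + 2) * 2 ^ s" unfolding z_def by (intro mult_le_mono2) simp
      ultimately have "?ones (?N s) \<le> ?ones (stage_start s) + 2 * s"
        by (rule match_count_ones_perturbed_gap)
      then have ones: "real (?ones (?N s)) \<le> real (?ones (stage_start s)) + 2 * real s" by linarith
      have "2 ^ s * c - 1 \<le> real (2 ^ s div (K + 2))"
        using real_div_nat_ge[of "2 ^ s" "K + 2"] by (simp add: c_def)
      then have "(real s + 2) * (2 ^ s * c - 1) \<le> real (z s)"
        unfolding z_def of_nat_mult using elim by (intro mult_mono) auto
      then have N: "real s * 2 ^ s + (real s + 2) * (2 ^ s * c - 1) \<le> real (?N s)"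
        by (simp add: stage_start_def)
      have pos: "0 < real s * 2 ^ s + (real s + 2) * (2 ^ s * c - 1)"
        using elim by (intro add_pos_pos mult_pos_pos) auto
      have "real (?ones (?N s)) / real (?N s) \<le> (real (?ones (stage_start s)) + 2 * real s) /
          (real s * 2 ^ s + (real s + 2) * (2 ^ s * c - 1))"
        using ones N pos by (intro frac_le) auto
      also have "\<dots> = ?b s"
      proof -
        have "(a + b) / d = (a / n + b / n) * (n / d)" if "n \<noteq> 0" for a b d n :: real
          using that by (simp add: add_divide_distrib[symmetric])
        moreover have "real (stage_start s) = real s * 2 ^ s" "real s * 2 ^ s \<noteq> 0"
          using elim by (auto simp: stage_start_def)
        ultimately show ?thesis by presburger
      qed
      finally show False using elim by simp
    qed
  qed
  with K show False by (simp add: frequently_def)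
qed

lemma normal_seq_perturbed_iff:
  "normal_seq (perturbed p q) \<longleftrightarrow> filterlim q at_top sequentially"
  using normal_seq_perturbed not_normal_seq_perturbed by blast

section \<open>Self-referential choice of the perturbation\<close>

lemma perturbed_cong:
  assumes "\<And>s. s \<le> stage i \<Longrightarrow> p s = p' s \<and> q s = q' s"
  shows "perturbed p q i = perturbed p' q' i"
  using assms[of "stage i"] by (simp add: perturbed_def peak_def gap_def Let_def)

text \<open>A contraction argument: stages up to \<open>s\<close> consult at most the first
  \<open>s\<close> digits, which lie before \<open>stage_start s\<close>. Each application of the
  map extends agreement by one stage, so the iterates converge to a fixed point.\<close>

lemma exists_perturbed_fixpoint:
  assumes P: "determined_by_prefix P" and Q: "determined_by_prefix Q"
  obtains x where "perturbed (P x) (Q x) = x"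
proof -
  define T where "T x = perturbed (P x) (Q x)" for x
  define agree where "agree s x y \<longleftrightarrow> (\<forall>i<stage_start s. x i = y i)" for s and x y :: "nat \<Rightarrow> bool"
  have T: "agree (Suc s) (T x) (T y)" if "agree s x y" for s x y
    unfolding agree_def
  proof (intro allI impI)
    fix i assume "i < stage_start (Suc s)"
    then have i: "stage i \<le> s" using le_stage_iff[of "Suc s" i] by linarith
    show "T x i = T y i"
      unfolding T_def
    proof (rule perturbed_cong)
      fix t assume "t \<le> stage i"
      then have "t \<le> stage_start s" using i stage_start_ge[of s] by linarith
      then have "x j = y j" if "j < t" for j using \<open>agree s x y\<close> that by (auto simp: agree_def)
      then show "P x t = P y t \<and> Q x t = Q y t"
        using determined_by_prefixD[OF P] determined_by_prefixD[OF Q] by metis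
    qed
  qed
  \<comment> \<open>Any starting sequence would do, since all sequences agree on the empty range
    below \<open>stage_start 0\<close>.\<close>
  define u where "u s = (T ^^ s) (\<lambda>_. False)" for s
  have u: "agree s (u s) (u (s + d))" for s d
  proof (induction s)
    case 0
    then show ?case by (simp add: agree_def stage_start_def)
  next
    case (Suc s)
    then show ?case using T[OF Suc] by (simp add: u_def)
  qed
  \<comment> \<open>Digit \<open>i\<close> no longer changes after \<open>Suc (stage i)\<close>
    iterations, because \<open>i\<close> lies below
    \<open>stage_start (Suc (stage i))\<close>.\<close>
  define x where "x i = u (Suc (stage i)) i" for i
  have x: "agree s (u s) x" for s
    unfolding agree_def
  proof (intro allI impI)
    fix i assume "i < stage_start s"
    then have "Suc (stage i) \<le> s" using le_stage_iff[of s i] by linarith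
    then obtain d where "s = Suc (stage i) + d" using le_Suc_ex by blast
    then show "u s i = x i"
      using u[of "Suc (stage i)" d] less_stage_start_Suc_stage[of i] by (simp add: agree_def x_def)
  qed
  have "x i = T x i" for i
  proof -
    have "agree (Suc i) (u (Suc i)) (T x)" using T[OF x[of i]] by (simp add: u_def)
    moreover have "i < stage_start (Suc i)" using stage_start_ge[of "Suc i"] by simp
    ultimately show ?thesis using x[of "Suc i"] by (simp add: agree_def)
  qed
  then show thesis by (intro that[of x]) (simp add: T_def fun_eq_iff)
qed

text \<open>For a fixed point, the parameters of the perturbation are the guesses about its own
  value, so their divergence decides both its properties and its membership.\<close>

lemma typical_normal_realization:
  assumes "pi03_in (top_of_set {0..1}) A" "pi03_in (top_of_set {0..1}) B"
  obtains y where "y \<in> {0..1}" "y \<in> TpcN \<longleftrightarrow> y \<in> A" "y \<in> Normal \<longleftrightarrow> y \<in> B"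
proof -
  obtain P :: "(nat \<Rightarrow> bool) \<Rightarrow> nat \<Rightarrow> nat" where P: "determined_by_prefix P"
    "\<And>x. bin_val x \<in> A \<longleftrightarrow> filterlim (P x) at_top sequentially"
    using pi03_prefix_reduction[OF assms(1)] by blast
  obtain Q :: "(nat \<Rightarrow> bool) \<Rightarrow> nat \<Rightarrow> nat" where Q: "determined_by_prefix Q"
    "\<And>x. bin_val x \<in> B \<longleftrightarrow> filterlim (Q x) at_top sequentially"
    using pi03_prefix_reduction[OF assms(2)] by blast
  obtain x where x: "perturbed (P x) (Q x) = x"
    using exists_perturbed_fixpoint[OF P(1) Q(1)] by blast
  let ?y = "bin_val x"
  note y = binary_expansion_bin_val[of x]
  have y01: "?y \<in> {0..1}" by (rule binary_expansion_bounds[OF y])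
  have unique: "x' = x" if "binary_expansion x' ?y" for x'
  proof (rule unique_binary_expansion_not_eventually_const[OF y that])
    fix n
    \<comment> \<open>\<open>Suc n\<close> avoids stage 0, whose planted run is empty.\<close>
    show "\<exists>i\<ge>n. x i"
      using perturbed_after_stage_start[of "Suc n" "P x" "Q x"] stage_start_ge[of "Suc n"]
      unfolding x by (intro exI[of _ "stage_start (Suc n) + 1"]) simp
    show "\<exists>i\<ge>n. \<not> x i"
      using not_perturbed_stage_start[of "P x" "Q x" n] stage_start_ge[of n] unfolding x
      by (intro exI[of _ "stage_start n"] conjI)
  qed
  have "?y \<in> TpcN \<longleftrightarrow> typical_seq x"
    using y y01 unique unfolding TpcN_def by blast
  also have "\<dots> \<longleftrightarrow> ?y \<in> A"
    using typical_seq_perturbed_iff[of "P x" "Q x"] P(2)[of x] unfolding x by simp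
  finally have "?y \<in> TpcN \<longleftrightarrow> ?y \<in> A" .
  moreover have "?y \<in> Normal \<longleftrightarrow> normal_seq x"
    using y y01 unique unfolding Normal_def by blast
  then have "?y \<in> Normal \<longleftrightarrow> ?y \<in> B"
    using normal_seq_perturbed_iff[of "P x" "Q x"] Q(2)[of x] unfolding x by simp
  ultimately show thesis using y01 by (intro that[of ?y])
qed

lemma pi03_in_topspace: "pi03_in X (topspace X)"
  by (rule pi03_inI[of "{}"]) auto

lemma pi03_in_empty: "pi03_in X {}"
  by (rule pi03_inI[of "{()}" _ "\<lambda>_. {}"]) auto

theorem theoremB:
  "TpcN - Normal \<noteq> {} \<and> Normal - TpcN \<noteq> {} \<and>
   D2_pi03_complete (top_of_set {0..1}) (TpcN - Normal) \<and>
   D2_pi03_complete (top_of_set {0..1}) (Normal - TpcN)"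
proof (intro conjI)
  let ?I = "top_of_set {0..1::real}"
  have I: "pi03_in ?I {0..1}" using pi03_in_topspace[of ?I] by simp
  show "TpcN - Normal \<noteq> {}"
    by (rule typical_normal_realization[OF I pi03_in_empty]) auto
  show "Normal - TpcN \<noteq> {}"
    by (rule typical_normal_realization[OF pi03_in_empty I]) auto
  have "\<not> (\<exists>C. D2 (pi03_in ?I) C \<and> S = topspace ?I - C)" if "S = TpcN - Normal \<or> S = Normal - TpcN" for S
  proof
    assume "\<exists>C. D2 (pi03_in ?I) C \<and> S = topspace ?I - C"
    then obtain A B where AB: "pi03_in ?I A" "pi03_in ?I B" "S = {0..1} - (A - B)"
      unfolding D2_def by auto
    from that show False
    proof
      assume "S = TpcN - Normal"
      with AB(3) have "TpcN - Normal = {0..1} - (A - B)" by simp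
      \<comment> \<open>The point obtained belongs to \<open>TpcN - Normal\<close> iff it belongs to
        \<open>A - B\<close>, hence to exactly one side of the equation.\<close>
      with typical_normal_realization[OF AB(1,2)] show False by blast
    next
      assume "S = Normal - TpcN"
      with AB(3) have "Normal - TpcN = {0..1} - (A - B)" by simp
      \<comment> \<open>With exchanged roles \<open>B\<close> governs typicality and
        \<open>A\<close> normality, so \<open>Normal - TpcN\<close> again corresponds to
        \<open>A - B\<close>.\<close>
      with typical_normal_realization[OF AB(2,1)] show False by blast
    qed
  qed
  then show "D2_pi03_complete ?I (TpcN - Normal)" "D2_pi03_complete ?I (Normal - TpcN)"
    unfolding D2_pi03_complete_def D2_pi03_hard_def using D2_pi03_diffs by blast+
qed

end
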